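(* Let $\varphi\colon B_n\to B_3$ be a homomorphism. \begin{enumerate} \item[(i)] If $n\geq5$, then $\varphi$ is cyclic. \item[(ii)] If $n=4$, then $\varphi$ factors through $R_*\colon B_4\twoheadrightarrow B_3$. \item[(iii)] If $n=3$ and $\varphi$ is non-cyclic, then, up to a transvection by a homomorphism $B_3\to Z(B_3)$ and post-composing by an automorphism of $B_3$, the map $\varphi$ has the form \[ \alpha\mapsto g\alpha g^{-1},\qquad \beta\mapsto\beta, \] for some $g\in B_3$. \end{enumerate}
   Context: $B_n$ is the braid group on $n$ strands with Artin generators $\sigma_1,\dots,\sigma_{n-1}$. $R_*\colon B_4\to B_3$ is the surjective homomorphism $\sigma_1,\sigma_3\mapsto\sigma_1$, $\sigma_2\mapsto\sigma_2$. In $B_3$ put $\alpha=\sigma_1\sigma_2$, $\beta=\sigma_1\sigma_2\sigma_1$, so $B_3=\langle\alpha,\beta\mid\alpha^3=\beta^2\rangle$, with center $Z(B_3)=\langle\alpha^3\rangle$. A homomorphism is cyclic if its image is a cyclic group. The transvection of $\varphi\colon G\to H$ by a cyclic homomorphism $t$ from $G$ to the centralizer of $\varphi(G)$ in $H$ is $\varphi^t(g)=\varphi(g)t(g)$. *)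

theory Defs
  imports "HOL-Algebra.Elementary_Groups"
begin

section \<open>Groups given by generators and relations\<close>

text \<open>A letter \<open>(x, True)\<close> stands for the generator \<open>x\<close>, and \<open>(x, False)\<close> for its formal inverse.
  A relation \<open>u = v\<close> is given as a pair of words \<open>(u, v)\<close>.\<close>

type_synonym 'g word = "('g \<times> bool) list"

inductive pres_eq :: "'g set \<Rightarrow> ('g word \<times> 'g word) set \<Rightarrow> 'g word \<Rightarrow> 'g word \<Rightarrow> bool"
  for S R where
  refl: "set w \<subseteq> S \<times> UNIV \<Longrightarrow> pres_eq S R w w"
| sym: "pres_eq S R u v \<Longrightarrow> pres_eq S R v u"
| trans: "pres_eq S R u v \<Longrightarrow> pres_eq S R v w \<Longrightarrow> pres_eq S R u w"
| append: "pres_eq S R u v \<Longrightarrow> pres_eq S R u' v' \<Longrightarrow> pres_eq S R (u @ u') (v @ v')"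
| cancel: "x \<in> S \<Longrightarrow> pres_eq S R [(x, b), (x, \<not> b)] []"
| rel: "(u, v) \<in> R \<Longrightarrow> set u \<subseteq> S \<times> UNIV \<Longrightarrow> set v \<subseteq> S \<times> UNIV \<Longrightarrow> pres_eq S R u v"

definition pres_class :: "'g set \<Rightarrow> ('g word \<times> 'g word) set \<Rightarrow> 'g word \<Rightarrow> 'g word set" where
  "pres_class S R w = {v. pres_eq S R w v}"

definition presented_group :: "'g set \<Rightarrow> ('g word \<times> 'g word) set \<Rightarrow> 'g word set monoid" where
  "presented_group S R =
    \<lparr>carrier = {pres_class S R w | w. set w \<subseteq> S \<times> UNIV},
     monoid.mult = (\<lambda>A B. \<Union>u\<in>A. \<Union>v\<in>B. pres_class S R (u @ v)),
     one = pres_class S R []\<rparr>"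

lemma pres_eq_words:
  assumes "pres_eq S R u v"
  shows "set u \<subseteq> S \<times> UNIV" "set v \<subseteq> S \<times> UNIV"
  using assms by (induction) auto

lemma pres_class_eq_iff:
  assumes "set u \<subseteq> S \<times> UNIV"
  shows "pres_class S R u = pres_class S R v \<longleftrightarrow> pres_eq S R u v"
proof
  assume "pres_class S R u = pres_class S R v"
  then have "pres_eq S R v u"
    using pres_eq.refl[OF assms, of R] unfolding pres_class_def by blast
  then show "pres_eq S R u v" by (rule pres_eq.sym)
next
  assume "pres_eq S R u v"
  then show "pres_class S R u = pres_class S R v"
    unfolding pres_class_def by (blast intro: pres_eq.sym pres_eq.trans)
qed

lemma pres_carrier: "carrier (presented_group S R) = {pres_class S R w | w. set w \<subseteq> S \<times> UNIV}"
  and pres_one: "\<one>\<^bsub>presented_group S R\<^esub> = pres_class S R []"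
  by (simp_all add: presented_group_def)

lemma pres_mult:
  assumes "set u \<subseteq> S \<times> UNIV" "set v \<subseteq> S \<times> UNIV"
  shows "pres_class S R u \<otimes>\<^bsub>presented_group S R\<^esub> pres_class S R v = pres_class S R (u @ v)"
proof -
  have "pres_class S R (u' @ v') = pres_class S R (u @ v)"
    if "u' \<in> pres_class S R u" "v' \<in> pres_class S R v" for u' v'
  proof -
    have "pres_eq S R (u @ v) (u' @ v')"
      using that unfolding pres_class_def by (simp add: pres_eq.append)
    then show ?thesis using pres_class_eq_iff[of "u @ v" S R "u' @ v'"] assms by simp
  qed
  moreover have "u \<in> pres_class S R u" "v \<in> pres_class S R v"
    using assms by (auto simp: pres_class_def intro: pres_eq.refl)
  ultimately have "(\<Union>u'\<in>pres_class S R u. \<Union>v'\<in>pres_class S R v. pres_class S R (u' @ v')) =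
      pres_class S R (u @ v)"
    by (intro equalityI UN_least) blast+
  then show ?thesis by (simp add: presented_group_def)
qed

definition inv_word :: "'g word \<Rightarrow> 'g word" where
  "inv_word w = rev (map (\<lambda>(x, b). (x, \<not> b)) w)"

lemma inv_word_words: "set w \<subseteq> S \<times> UNIV \<Longrightarrow> set (inv_word w) \<subseteq> S \<times> UNIV"
  unfolding inv_word_def by auto

lemma pres_eq_inv_word:
  assumes "set w \<subseteq> S \<times> UNIV"
  shows "pres_eq S R (inv_word w @ w) []"
  using assms
proof (induction w)
  case Nil
  then show ?case by (simp add: inv_word_def pres_eq.refl)
next
  case (Cons a w)
  obtain x b where a: "a = (x, b)" by (cases a)
  with Cons have x: "x \<in> S" and w: "set w \<subseteq> S \<times> UNIV" by auto
  have c: "pres_eq S R [(x, \<not> b), (x, b)] []"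
    using pres_eq.cancel[OF x, of R "\<not> b"] by simp
  have "pres_eq S R (inv_word w @ ([(x, \<not> b), (x, b)] @ w)) (inv_word w @ ([] @ w))"
    by (intro pres_eq.append c pres_eq.refl w inv_word_words)
  then have "pres_eq S R (inv_word w @ [(x, \<not> b), (x, b)] @ w) []"
    using pres_eq.trans[OF _ Cons.IH[OF w]] by simp
  then show ?case by (simp add: inv_word_def a)
qed

lemma group_presented_group: "group (presented_group S R)"
proof (rule groupI)
  fix X assume "X \<in> carrier (presented_group S R)"
  then obtain w where w: "X = pres_class S R w" "set w \<subseteq> S \<times> UNIV"
    by (auto simp: pres_carrier)
  have "pres_class S R (inv_word w) \<otimes>\<^bsub>presented_group S R\<^esub> X = \<one>\<^bsub>presented_group S R\<^esub>"
    using w inv_word_words[OF w(2)] pres_eq_inv_word[OF w(2), of R]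
      pres_class_eq_iff[of "inv_word w @ w" S R "[]"]
    by (simp add: pres_mult pres_one)
  then show "\<exists>Y\<in>carrier (presented_group S R). Y \<otimes>\<^bsub>presented_group S R\<^esub> X = \<one>\<^bsub>presented_group S R\<^esub>"
    using inv_word_words[OF w(2)] by (auto simp: pres_carrier)
next
  fix X Y assume "X \<in> carrier (presented_group S R)" "Y \<in> carrier (presented_group S R)"
  then obtain u v where uv: "X = pres_class S R u" "Y = pres_class S R v"
    "set u \<subseteq> S \<times> UNIV" "set v \<subseteq> S \<times> UNIV"
    by (auto simp: pres_carrier)
  then have "set (u @ v) \<subseteq> S \<times> UNIV" by simp
  then show "X \<otimes>\<^bsub>presented_group S R\<^esub> Y \<in> carrier (presented_group S R)"
    unfolding uv(1,2) pres_mult[OF uv(3,4)] pres_carrier by blast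
next
  show "\<one>\<^bsub>presented_group S R\<^esub> \<in> carrier (presented_group S R)"
    unfolding pres_carrier pres_one by (rule CollectI, rule exI[of _ "[]"]) simp
qed (auto simp: pres_carrier pres_one pres_mult)


section \<open>Braid groups\<close>

definition braid_relations :: "nat \<Rightarrow> (nat word \<times> nat word) set" where
  "braid_relations n =
     {([(i, True), (j, True)], [(j, True), (i, True)]) | i j.
        i \<in> {1..<n} \<and> j \<in> {1..<n} \<and> i + 2 \<le> j} \<union>
     {([(i, True), (i + 1, True), (i, True)], [(i + 1, True), (i, True), (i + 1, True)]) | i.
        i \<in> {1..<n} \<and> i + 1 \<in> {1..<n}}"

definition braid_group :: "nat \<Rightarrow> nat word set monoid" where
  "braid_group n = presented_group {1..<n} (braid_relations n)"

definition braid_class :: "nat \<Rightarrow> nat word \<Rightarrow> nat word set" where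
  "braid_class n = pres_class {1..<n} (braid_relations n)"

definition artin :: "nat \<Rightarrow> nat \<Rightarrow> nat word set" where
  "artin n i = braid_class n [(i, True)]"

lemma group_braid_group: "group (braid_group n)"
  unfolding braid_group_def by (rule group_presented_group)

lemma artin_closed: "i \<in> {1..<n} \<Longrightarrow> artin n i \<in> carrier (braid_group n)"
  unfolding artin_def braid_class_def braid_group_def pres_carrier
  by (rule CollectI, rule exI[of _ "[(i, True)]"]) simp

lemma artin_commute:
  assumes "i \<in> {1..<n}" "j \<in> {1..<n}" "i + 2 \<le> j"
  shows "artin n i \<otimes>\<^bsub>braid_group n\<^esub> artin n j = artin n j \<otimes>\<^bsub>braid_group n\<^esub> artin n i"
proof -
  have "pres_eq {1..<n} (braid_relations n) [(i, True), (j, True)] [(j, True), (i, True)]"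
    using assms by (intro pres_eq.rel) (auto simp: braid_relations_def)
  then show ?thesis
    using assms unfolding artin_def braid_class_def braid_group_def
    by (simp add: pres_mult pres_class_eq_iff)
qed

lemma artin_braid:
  assumes "i \<in> {1..<n}" "i + 1 \<in> {1..<n}"
  shows "artin n i \<otimes>\<^bsub>braid_group n\<^esub> artin n (i + 1) \<otimes>\<^bsub>braid_group n\<^esub> artin n i =
    artin n (i + 1) \<otimes>\<^bsub>braid_group n\<^esub> artin n i \<otimes>\<^bsub>braid_group n\<^esub> artin n (i + 1)"
proof -
  have "pres_eq {1..<n} (braid_relations n)
      [(i, True), (i + 1, True), (i, True)] [(i + 1, True), (i, True), (i + 1, True)]"
    using assms by (intro pres_eq.rel) (auto simp: braid_relations_def)
  then show ?thesis
    using assms unfolding artin_def braid_class_def braid_group_def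
    by (simp add: pres_mult pres_class_eq_iff)
qed

definition alpha :: "nat word set" where
  "alpha = artin 3 1 \<otimes>\<^bsub>braid_group 3\<^esub> artin 3 2"

definition beta :: "nat word set" where
  "beta = artin 3 1 \<otimes>\<^bsub>braid_group 3\<^esub> artin 3 2 \<otimes>\<^bsub>braid_group 3\<^esub> artin 3 1"


section \<open>The homomorphism from the four-strand to the three-strand braid group\<close>

definition R_word :: "nat word \<Rightarrow> nat word" where
  "R_word = map (\<lambda>(i, b). (if i = 3 then 1 else i, b))"

text \<open>Independent of the choice of the word \<open>w\<close> in the class, see \<open>R_star_class\<close> below.\<close>

definition R_star :: "nat word set \<Rightarrow> nat word set" where
  "R_star X = (\<Union>w\<in>X. braid_class 3 (R_word w))"

lemma R_word_words: "set w \<subseteq> {1..<4} \<times> UNIV \<Longrightarrow> set (R_word w) \<subseteq> {1..<3} \<times> UNIV"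
  unfolding R_word_def by force

lemma R_word_relation:
  assumes "(u, v) \<in> braid_relations 4"
  shows "pres_eq {1..<3} (braid_relations 3) (R_word u) (R_word v)"
proof -
  let ?E = "pres_eq {1..<3} (braid_relations 3)"
  have aba: "?E [(1, True), (2, True), (1, True)] [(2, True), (1, True), (2, True)]"
    by (rule pres_eq.rel) (auto simp: braid_relations_def)
  have aa: "?E [(1, True), (1, True)] [(1, True), (1, True)]"
    by (rule pres_eq.refl) auto
  from assms consider
      (far) i j where "u = [(i, True), (j, True)]" "v = [(j, True), (i, True)]"
        "i \<in> {1..<4}" "j \<in> {1..<4}" "i + 2 \<le> j"
    | (near) i where "u = [(i, True), (i + 1, True), (i, True)]"
        "v = [(i + 1, True), (i, True), (i + 1, True)]" "i \<in> {1..<4}" "i + 1 \<in> {1..<4}"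
    unfolding braid_relations_def by blast
  then show ?thesis
  proof cases
    case far
    then have "i = 1" "j = 3" by auto
    with far aa show ?thesis by (simp add: R_word_def)
  next
    case near
    then consider "i = 1" | "i = 2" by fastforce
    then show ?thesis
    proof cases
      case 1
      then show ?thesis using near aba by (simp add: R_word_def numeral_2_eq_2)
    next
      case 2
      then show ?thesis using near pres_eq.sym[OF aba] by (simp add: R_word_def)
    qed
  qed
qed

lemma R_word_pres_eq:
  assumes "pres_eq {1..<4} (braid_relations 4) u v"
  shows "pres_eq {1..<3} (braid_relations 3) (R_word u) (R_word v)"
  using assms
proof (induction)
  case (refl w)
  then show ?case by (intro pres_eq.refl R_word_words)
next
  case (sym u v)
  show ?case by (rule pres_eq.sym[OF sym.IH])
next
  case (trans u v w)
  show ?case by (rule pres_eq.trans[OF trans.IH])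
next
  case (append u v u' v')
  show ?case using pres_eq.append[OF append.IH] by (simp add: R_word_def)
next
  case (cancel x b)
  then have "(if x = 3 then 1 else x) \<in> {1..<3}" by auto
  from pres_eq.cancel[OF this, of _ b] show ?case by (simp add: R_word_def)
next
  case (rel u v)
  then show ?case by (intro R_word_relation)
qed

lemma R_star_class:
  assumes "set w \<subseteq> {1..<4} \<times> UNIV"
  shows "R_star (braid_class 4 w) = braid_class 3 (R_word w)"
proof -
  have "braid_class 3 (R_word v) = braid_class 3 (R_word w)" if "v \<in> braid_class 4 w" for v
    using that R_word_pres_eq pres_class_eq_iff[OF R_word_words[OF assms]]
    unfolding braid_class_def pres_class_def[of "{1..<4}"] by blast
  moreover have "w \<in> braid_class 4 w"
    using assms by (simp add: braid_class_def pres_class_def pres_eq.refl)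
  ultimately show ?thesis unfolding R_star_def by blast
qed

lemma R_star_artin:
  "R_star (artin 4 1) = artin 3 1" "R_star (artin 4 2) = artin 3 2" "R_star (artin 4 3) = artin 3 1"
  by (simp_all add: artin_def R_star_class R_word_def)

lemma R_star_hom: "R_star \<in> hom (braid_group 4) (braid_group 3)"
proof (rule homI)
  fix X assume "X \<in> carrier (braid_group 4)"
  then obtain u where u: "X = braid_class 4 u" "set u \<subseteq> {1..<4} \<times> UNIV"
    unfolding braid_group_def braid_class_def pres_carrier by blast
  then show "R_star X \<in> carrier (braid_group 3)"
    using R_star_class R_word_words unfolding braid_group_def braid_class_def pres_carrier by blast
next
  fix X Y assume "X \<in> carrier (braid_group 4)" "Y \<in> carrier (braid_group 4)"
  then obtain u v where uv: "X = braid_class 4 u" "Y = braid_class 4 v"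
    "set u \<subseteq> {1..<4} \<times> UNIV" "set v \<subseteq> {1..<4} \<times> UNIV"
    unfolding braid_group_def braid_class_def pres_carrier by blast
  have "R_star (X \<otimes>\<^bsub>braid_group 4\<^esub> Y) = R_star (braid_class 4 (u @ v))"
    using uv unfolding braid_group_def braid_class_def by (simp add: pres_mult)
  also have "\<dots> = braid_class 3 (R_word u @ R_word v)"
    using uv by (simp add: R_star_class R_word_def)
  also have "\<dots> = R_star X \<otimes>\<^bsub>braid_group 3\<^esub> R_star Y"
    using uv R_word_words by (simp add: R_star_class) (simp add: braid_group_def braid_class_def pres_mult)
  finally show "R_star (X \<otimes>\<^bsub>braid_group 4\<^esub> Y) = R_star X \<otimes>\<^bsub>braid_group 3\<^esub> R_star Y" .
qed

lemma R_star_epi: "R_star \<in> epi (braid_group 4) (braid_group 3)"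
proof -
  have "Y \<in> R_star ` carrier (braid_group 4)" if Y: "Y \<in> carrier (braid_group 3)" for Y
  proof -
    obtain w where w: "Y = braid_class 3 w" "set w \<subseteq> {1..<3} \<times> UNIV"
      using Y unfolding braid_group_def braid_class_def pres_carrier by blast
    have "({1..<3} :: nat set) \<subseteq> {1..<4}" by auto
    then have w4: "set w \<subseteq> {1..<4} \<times> UNIV" using w(2) by blast
    have "(\<lambda>(i, b). (if i = 3 then 1 else i, b)) p = p" if "p \<in> set w" for p :: "nat \<times> bool"
      using subsetD[OF w(2) that] by (cases p) simp
    then have "R_word w = w"
      unfolding R_word_def by (rule map_idI)
    then have "R_star (braid_class 4 w) = Y" using R_star_class[OF w4] w by simp
    moreover have "braid_class 4 w \<in> carrier (braid_group 4)"
      using w4 unfolding braid_group_def braid_class_def pres_carrier by blast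
    ultimately show ?thesis by blast
  qed
  moreover have "R_star ` carrier (braid_group 4) \<subseteq> carrier (braid_group 3)"
    using R_star_hom by (simp add: hom_def image_subset_iff_funcset)
  ultimately show ?thesis using R_star_hom unfolding epi_def by blast
qed


section \<open>Cyclic homomorphisms, centralizers and transvections\<close>

definition cyclic_hom :: "('a, 'c) monoid_scheme \<Rightarrow> ('b, 'd) monoid_scheme \<Rightarrow> ('a \<Rightarrow> 'b) \<Rightarrow> bool" where
  "cyclic_hom G H \<phi> \<longleftrightarrow> \<phi> \<in> hom G H \<and> cyclic_group (H\<lparr>carrier := \<phi> ` carrier G\<rparr>)"

definition centralizer :: "('b, 'd) monoid_scheme \<Rightarrow> 'b set \<Rightarrow> 'b set" where
  "centralizer H A = {h \<in> carrier H. \<forall>a\<in>A. h \<otimes>\<^bsub>H\<^esub> a = a \<otimes>\<^bsub>H\<^esub> h}"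

definition center :: "('b, 'd) monoid_scheme \<Rightarrow> 'b set" where
  "center H = centralizer H (carrier H)"

definition transvection_datum ::
    "('a, 'c) monoid_scheme \<Rightarrow> ('b, 'd) monoid_scheme \<Rightarrow> ('a \<Rightarrow> 'b) \<Rightarrow> ('a \<Rightarrow> 'b) \<Rightarrow> bool" where
  "transvection_datum G H \<phi> t \<longleftrightarrow>
     cyclic_hom G (H\<lparr>carrier := centralizer H (\<phi> ` carrier G)\<rparr>) t"

definition transvection ::
    "('b, 'd) monoid_scheme \<Rightarrow> ('a \<Rightarrow> 'b) \<Rightarrow> ('a \<Rightarrow> 'b) \<Rightarrow> 'a \<Rightarrow> 'b" where
  "transvection H \<phi> t g = \<phi> g \<otimes>\<^bsub>H\<^esub> t g"

end

theory Submission
  imports Defs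
begin

text \<open>The map \<open>\<sigma>\<^sub>1 \<mapsto> [[1,-1],[0,1]]\<close>, \<open>\<sigma>\<^sub>2 \<mapsto> [[1,0],[1,1]]\<close>, together with the exponent sum, embeds
  \<open>B\<^sub>3\<close> in \<open>SL\<^sub>2(\<int>) \<times> \<int>\<close>: modulo the centre, every element of \<open>B\<^sub>3\<close> is conjugate to \<open>1\<close>, \<open>\<alpha>\<close>,
  \<open>\<alpha>\<^sup>-\<^sup>1\<close>, \<open>\<beta>\<close> or a nonempty product of \<open>\<sigma>\<^sub>1\<^sup>-\<^sup>1\<close> and \<open>\<sigma>\<^sub>2\<close>, and only \<open>1\<close> has a scalar image,
  since the images of such products are non-scalar matrices with nonnegative entries.

  For (ii), \<open>\<sigma>\<^sub>1\<close> and \<open>\<sigma>\<^sub>3\<close> commute and both satisfy the braid relation with \<open>\<sigma>\<^sub>2\<close>; comparing traces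
  of the images in \<open>SL\<^sub>2(\<int>)\<close> forces them to be equal, as \<open>2\<close> is not a square. Part (i) follows by
  applying this to consecutive triples of generators. For (iii), let \<open>a\<close>, \<open>b\<close> be the images of \<open>\<alpha>\<close>,
  \<open>\<beta>\<close>. The centralizer of a non-scalar matrix is commutative, so \<open>a\<^sup>3 = b\<^sup>2\<close> is central; the normal
  form then makes \<open>a\<close> a conjugate of \<open>\<alpha>\<^sup>\<plusminus>\<^sup>1\<close> and \<open>b\<close> a conjugate of \<open>\<beta>\<close> up to the centre, and the
  exponent sum determines the central factors.\<close>

section \<open>Homomorphisms out of a presented group\<close>

primrec word_value :: "('a, 'c) monoid_scheme \<Rightarrow> ('g \<Rightarrow> 'a) \<Rightarrow> 'g word \<Rightarrow> 'a" where
  "word_value G f [] = \<one>\<^bsub>G\<^esub>"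
| "word_value G f (p # w) =
    (if snd p then f (fst p) else inv\<^bsub>G\<^esub> f (fst p)) \<otimes>\<^bsub>G\<^esub> word_value G f w"

context group begin

section \<open>Evaluation of words and the universal property of a presentation\<close>

lemma word_value_closed [simp]:
  "set w \<subseteq> S \<times> UNIV \<Longrightarrow> f ` S \<subseteq> carrier G \<Longrightarrow> word_value G f w \<in> carrier G"
  by (induction w) auto

lemma word_value_append:
  assumes "set u \<subseteq> S \<times> UNIV" "set v \<subseteq> S \<times> UNIV" "f ` S \<subseteq> carrier G"
  shows "word_value G f (u @ v) = word_value G f u \<otimes> word_value G f v"
  using assms(1)
proof (induction u)
  case Nil
  then show ?case using assms by simp
next
  case (Cons p u)
  then have "f (fst p) \<in> carrier G" using assms(3) by auto
  with Cons show ?case using assms by (auto simp: m_assoc)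
qed

lemma word_value_pres_eq:
  assumes f: "f ` S \<subseteq> carrier G"
    and R: "\<And>u v. (u, v) \<in> R \<Longrightarrow> word_value G f u = word_value G f v"
    and "pres_eq S R u v"
  shows "word_value G f u = word_value G f v"
  using assms(3)
proof (induction)
  case (append u v u' v')
  note w = pres_eq_words[OF append.hyps(1)] pres_eq_words[OF append.hyps(2)]
  show ?case
    using append.IH w f by (simp add: word_value_append[where S = S])
next
  case (cancel x b)
  then have "f x \<in> carrier G" using f by auto
  then show ?case by simp
qed (auto intro: R)

text \<open>Von Dyck's theorem. Evaluation of words is constant on the classes, so the
  representative picked by \<open>SOME\<close> does not affect the value.\<close>

lemma presented_group_lift:
  assumes f: "f ` S \<subseteq> carrier G"
    and R: "\<And>u v. (u, v) \<in> R \<Longrightarrow> word_value G f u = word_value G f v"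
  obtains h where "h \<in> hom (presented_group S R) G"
    "\<And>w. set w \<subseteq> S \<times> UNIV \<Longrightarrow> h (pres_class S R w) = word_value G f w"
proof -
  define h where "h X = word_value G f (SOME w. w \<in> X)" for X
  have h: "h (pres_class S R w) = word_value G f w" if w: "set w \<subseteq> S \<times> UNIV" for w
  proof -
    have "w \<in> pres_class S R w" using w by (simp add: pres_class_def pres_eq.refl)
    then have "(SOME v. v \<in> pres_class S R w) \<in> pres_class S R w" by (rule someI)
    then have "pres_eq S R w (SOME v. v \<in> pres_class S R w)"
      by (simp add: pres_class_def)
    from word_value_pres_eq[OF f R this] show ?thesis by (simp add: h_def)
  qed
  have "h \<in> hom (presented_group S R) G"
  proof (rule homI)
    fix X assume "X \<in> carrier (presented_group S R)"
    then obtain u where "X = pres_class S R u" "set u \<subseteq> S \<times> UNIV"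
      by (auto simp: pres_carrier)
    then show "h X \<in> carrier G" using f by (simp add: h)
  next
    fix X Y assume "X \<in> carrier (presented_group S R)" "Y \<in> carrier (presented_group S R)"
    then obtain u v where uv: "X = pres_class S R u" "set u \<subseteq> S \<times> UNIV"
      "Y = pres_class S R v" "set v \<subseteq> S \<times> UNIV"
      by (auto simp: pres_carrier)
    then have "set (u @ v) \<subseteq> S \<times> UNIV" by simp
    from h[OF this] uv f
    show "h (X \<otimes>\<^bsub>presented_group S R\<^esub> Y) = h X \<otimes> h Y"
      by (simp add: h pres_mult word_value_append[where S = S])
  qed
  with h that show ?thesis by blast
qed

end

lemma pres_class_Cons:
  assumes "x \<in> S" "set w \<subseteq> S \<times> UNIV"
  shows "pres_class S R ((x, b) # w) = (if b then pres_class S R [(x, True)]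
      else inv\<^bsub>presented_group S R\<^esub> pres_class S R [(x, True)])
    \<otimes>\<^bsub>presented_group S R\<^esub> pres_class S R w"
proof -
  interpret group "presented_group S R" by (rule group_presented_group)
  have car: "pres_class S R [(x, b)] \<in> carrier (presented_group S R)" for b
    using assms unfolding pres_carrier by (intro CollectI exI[of _ "[(x, b)]"]) simp
  have "pres_class S R [(x, False), (x, True)] = pres_class S R []"
    using assms pres_eq.cancel[of x S R False]
    by (subst pres_class_eq_iff) auto
  then have "pres_class S R [(x, False)] \<otimes>\<^bsub>presented_group S R\<^esub> pres_class S R [(x, True)]
      = \<one>\<^bsub>presented_group S R\<^esub>"
    using assms by (simp add: pres_mult pres_one)
  then have "inv\<^bsub>presented_group S R\<^esub> pres_class S R [(x, True)] = pres_class S R [(x, False)]"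
    using car by (intro inv_equality) auto
  moreover have "pres_class S R [(x, b)] \<otimes>\<^bsub>presented_group S R\<^esub> pres_class S R w
      = pres_class S R ((x, b) # w)"
    using assms by (simp add: pres_mult)
  ultimately show ?thesis by (cases b) auto
qed

text \<open>The uniqueness half of the universal property: peeling off one letter multiplies by a
  generator or its inverse, so the values on the generators determine the homomorphism.\<close>

lemma (in group) hom_pres_class:
  assumes h: "h \<in> hom (presented_group S R) G" and w: "set w \<subseteq> S \<times> UNIV"
  shows "h (pres_class S R w) = word_value G (\<lambda>x. h (pres_class S R [(x, True)])) w"
  using w
proof (induction w)
  interpret h: group_hom "presented_group S R" G h
    using h by (simp add: group_hom_def group_hom_axioms_def group_presented_group)
  {
    case Nil
    show ?case using h.hom_one by (simp add: pres_one)
  next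
    case (Cons p w)
    obtain x b where p: "p = (x, b)" by (cases p)
    with Cons.prems have x: "x \<in> S" and w: "set w \<subseteq> S \<times> UNIV" by auto
    have "pres_class S R v \<in> carrier (presented_group S R)" if "set v \<subseteq> S \<times> UNIV" for v
      using that by (auto simp: pres_carrier)
    from this[of "[(x, True)]"] this[OF w] show ?case
      using x Cons.IH[OF w] unfolding p pres_class_Cons[OF x w] by simp
  }
qed

section \<open>The braid groups\<close>

lemma braid_carrierE:
  assumes "X \<in> carrier (braid_group n)"
  obtains w where "X = braid_class n w" "set w \<subseteq> {1..<n} \<times> UNIV"
  using assms by (auto simp: braid_group_def braid_class_def pres_carrier)

lemma braid_class_closed:
  "set w \<subseteq> {1..<n} \<times> UNIV \<Longrightarrow> braid_class n w \<in> carrier (braid_group n)"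
  by (auto simp: braid_group_def braid_class_def pres_carrier)

lemma (in group) hom_braid_class:
  assumes "h \<in> hom (braid_group n) G" and "set w \<subseteq> {1..<n} \<times> UNIV"
  shows "h (braid_class n w) = word_value G (\<lambda>i. h (artin n i)) w"
  using hom_pres_class[of h "{1..<n}" "braid_relations n" w] assms
  unfolding braid_group_def braid_class_def artin_def by simp

lemma word_value_cong:
  "set w \<subseteq> S \<times> UNIV \<Longrightarrow> (\<And>x. x \<in> S \<Longrightarrow> f x = g x) \<Longrightarrow> word_value G f w = word_value G g w"
  by (induction w) auto

lemma (in group) braid_hom_eqI:
  assumes "h \<in> hom (braid_group n) G" "k \<in> hom (braid_group n) G"
    and "\<And>i. i \<in> {1..<n} \<Longrightarrow> h (artin n i) = k (artin n i)"
    and "X \<in> carrier (braid_group n)"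
  shows "h X = k X"
proof -
  obtain w where "X = braid_class n w" "set w \<subseteq> {1..<n} \<times> UNIV"
    using braid_carrierE[OF assms(4)] .
  then show ?thesis
    using word_value_cong[of w "{1..<n}" "\<lambda>i. h (artin n i)" "\<lambda>i. k (artin n i)" G] assms(3)
    by (simp add: hom_braid_class[OF assms(1)] hom_braid_class[OF assms(2)])
qed

lemma (in group) braid3_lift:
  assumes xy: "x \<in> carrier G" "y \<in> carrier G" and braid: "x \<otimes> y \<otimes> x = y \<otimes> x \<otimes> y"
  obtains h where "h \<in> hom (braid_group 3) G" "h (artin 3 1) = x" "h (artin 3 2) = y"
proof -
  define f where "f i = (if i = (1::nat) then x else y)" for i
  have f: "f ` {1..<3} \<subseteq> carrier G" using xy by (auto simp: f_def)
  have "word_value G f u = word_value G f v" if "(u, v) \<in> braid_relations 3" for u v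
  proof -
    \<comment> \<open>On three strands no two indices are far apart, so the braid relation for index
      1 is the only relation.\<close>
    from that have "u = [(1, True), (2, True), (1, True)]" "v = [(2, True), (1, True), (2, True)]"
      by (auto simp: braid_relations_def)
    then show ?thesis using xy braid by (simp add: f_def m_assoc)
  qed
  from presented_group_lift[OF f this] obtain h where "h \<in> hom (braid_group 3) G"
    and h: "\<And>w. set w \<subseteq> {1..<3} \<times> UNIV \<Longrightarrow> h (braid_class 3 w) = word_value G f w"
    unfolding braid_group_def braid_class_def by metis
  moreover have "h (artin 3 1) = x" "h (artin 3 2) = y"
    using xy by (simp_all add: artin_def h f_def)
  ultimately show ?thesis using that by blast
qed

lemma braid_hom_relations:
  assumes h: "h \<in> hom (braid_group n) H"
  shows "i \<in> {1..<n} \<Longrightarrow> h (artin n i) \<in> carrier H"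
    and "\<lbrakk>i \<in> {1..<n}; i + 1 \<in> {1..<n}\<rbrakk> \<Longrightarrow>
      h (artin n i) \<otimes>\<^bsub>H\<^esub> h (artin n (i + 1)) \<otimes>\<^bsub>H\<^esub> h (artin n i)
        = h (artin n (i + 1)) \<otimes>\<^bsub>H\<^esub> h (artin n i) \<otimes>\<^bsub>H\<^esub> h (artin n (i + 1))"
    and "\<lbrakk>i \<in> {1..<n}; j \<in> {1..<n}; i + 2 \<le> j\<rbrakk> \<Longrightarrow>
      h (artin n i) \<otimes>\<^bsub>H\<^esub> h (artin n j) = h (artin n j) \<otimes>\<^bsub>H\<^esub> h (artin n i)"
proof -
  interpret B: group "braid_group n" by (rule group_braid_group)
  note m = hom_mult[OF h]
  show "h (artin n i) \<in> carrier H" if "i \<in> {1..<n}"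
    using that h artin_closed by (blast intro: hom_in_carrier)
  show "h (artin n i) \<otimes>\<^bsub>H\<^esub> h (artin n (i + 1)) \<otimes>\<^bsub>H\<^esub> h (artin n i)
      = h (artin n (i + 1)) \<otimes>\<^bsub>H\<^esub> h (artin n i) \<otimes>\<^bsub>H\<^esub> h (artin n (i + 1))"
    if "i \<in> {1..<n}" "i + 1 \<in> {1..<n}"
    using arg_cong[OF artin_braid[OF that], of h] artin_closed[OF that(1)] artin_closed[OF that(2)]
    by (simp only: m B.m_closed)
  show "h (artin n i) \<otimes>\<^bsub>H\<^esub> h (artin n j) = h (artin n j) \<otimes>\<^bsub>H\<^esub> h (artin n i)"
    if "i \<in> {1..<n}" "j \<in> {1..<n}" "i + 2 \<le> j"
    using arg_cong[OF artin_commute[OF that], of h] artin_closed[OF that(1)] artin_closed[OF that(2)]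
    by (simp only: m)
qed

text \<open>Commuting turns y x y into x y y, and then x y cancels on the left of x y x = x y
  y.\<close>

lemma (in group) braid_commute_imp_eq:
  assumes "x \<in> carrier G" "y \<in> carrier G" "x \<otimes> y \<otimes> x = y \<otimes> x \<otimes> y" "x \<otimes> y = y \<otimes> x"
  shows "x = y"
proof -
  have "(x \<otimes> y) \<otimes> x = (x \<otimes> y) \<otimes> y" by (simp only: assms(3) assms(4)[symmetric])
  then show ?thesis using assms(1,2) by (simp only: Units_l_cancel Units_eq m_closed)
qed

lemma (in group) cyclic_hom_if_artin_eq:
  assumes h: "h \<in> hom (braid_group n) G" and n: "n \<ge> 2"
    and eq: "\<And>i. i \<in> {1..<n} \<Longrightarrow> h (artin n i) = s"
  shows "cyclic_hom (braid_group n) G h"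
proof -
  interpret h: group_hom "braid_group n" G h
    using h by (simp add: group_hom_def group_hom_axioms_def group_braid_group is_group)
  let ?I = "G\<lparr>carrier := h ` carrier (braid_group n)\<rparr>"
  have sub: "subgroup (h ` carrier (braid_group n)) G" by (rule h.img_is_subgroup)
  interpret I: group ?I by (rule subgroup_imp_group[OF sub])
  \<comment> \<open>The bound \<open>n \<ge> 2\<close> provides the generator
    \<open>artin n 1\<close>, whose value under \<open>h\<close> puts \<open>s\<close> into the
    image.\<close>
  have s: "s \<in> carrier ?I" "s \<in> carrier G"
    using eq[of 1] n artin_closed[of 1 n] h.hom_closed by (auto intro!: image_eqI)
  have pow: "s [^]\<^bsub>?I\<^esub> k = s [^] k" for k :: int
    using int_pow_consistent[OF sub] s by simp
  have "word_value G (\<lambda>i. s) w \<in> range (\<lambda>k::int. s [^] k)" if "set w \<subseteq> {1..<n} \<times> UNIV" for w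
    using that
  proof (induction w)
    case Nil
    show ?case by (auto intro!: image_eqI[of _ _ 0])
  next
    case (Cons p w)
    then obtain k :: int where "word_value G (\<lambda>i. s) w = s [^] k" by auto
    moreover have "s = s [^] (1::int)" "inv s = s [^] (- 1::int)"
      using s by (simp_all add: int_pow_neg)
    ultimately have "word_value G (\<lambda>i. s) (p # w) = s [^] ((if snd p then 1 else -1) + k)"
      using s by (simp add: int_pow_mult)
    then show ?case by blast
  qed
  moreover have "h (braid_class n w) = word_value G (\<lambda>i. s) w" if "set w \<subseteq> {1..<n} \<times> UNIV" for w
    using hom_braid_class[OF h that] word_value_cong[OF that eq] by simp
  ultimately have "h X \<in> range (\<lambda>k::int. s [^] k)" if "X \<in> carrier (braid_group n)" for X
    using braid_carrierE[OF that] by metis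
  moreover have "s [^] k \<in> carrier ?I" for k :: int
    using I.int_pow_closed[OF s(1), of k] pow by simp
  ultimately have "carrier ?I = range (\<lambda>k::int. s [^]\<^bsub>?I\<^esub> k)"
    unfolding pow by auto
  then show ?thesis using h s unfolding cyclic_hom_def I.cyclic_group by blast
qed

section \<open>Integer matrices of size two\<close>

text \<open>With four explicit entries, matrix identities become polynomial identities between
  integers, and the \<open>ring_1\<close> instance makes \<open>of_int k\<close> the scalar matrix
  with entry \<open>k\<close>.\<close>

datatype mat2 = Mat int int int int

instantiation mat2 :: ring_1
begin
fun plus_mat2 where "plus_mat2 (Mat a b c d) (Mat a' b' c' d') = Mat (a + a') (b + b') (c + c') (d + d')"
fun minus_mat2 where "minus_mat2 (Mat a b c d) (Mat a' b' c' d') = Mat (a - a') (b - b') (c - c') (d - d')"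
fun uminus_mat2 where "uminus_mat2 (Mat a b c d) = Mat (- a) (- b) (- c) (- d)"
fun times_mat2 where "times_mat2 (Mat a b c d) (Mat a' b' c' d') =
  Mat (a * a' + b * c') (a * b' + b * d') (c * a' + d * c') (c * b' + d * d')"
definition "0 = Mat 0 0 0 0"
definition "1 = Mat 1 0 0 1"
instance
proof
  fix A B C :: mat2
  show "A * B * C = A * (B * C)" "(A + B) * C = A * C + B * C" "A * (B + C) = A * B + A * C"
    by (cases A; cases B; cases C; simp add: algebra_simps)+
  show "A + B + C = A + (B + C)" "A + B = B + A" "A - B = A + - B"
    by (cases A; cases B; cases C; simp)+
  show "0 + A = A" "- A + A = 0" "1 * A = A" "A * 1 = A" "(0::mat2) \<noteq> 1"
    by (cases A; simp add: zero_mat2_def one_mat2_def)+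
qed
end

primrec det2 :: "mat2 \<Rightarrow> int" where "det2 (Mat a b c d) = a * d - b * c"
primrec tr2 :: "mat2 \<Rightarrow> int" where "tr2 (Mat a b c d) = a + d"
primrec adj2 :: "mat2 \<Rightarrow> mat2" where "adj2 (Mat a b c d) = Mat d (- b) (- c) a"

primrec scalar2 :: "mat2 \<Rightarrow> bool" where
  "scalar2 (Mat a b c d) \<longleftrightarrow> b = 0 \<and> c = 0 \<and> a = d"

lemma of_int_mat2: "of_int k = Mat k 0 0 k"
proof (induction k rule: int_induct[where k = 0])
  case base
  show ?case by (simp add: zero_mat2_def)
next
  case (step1 i)
  then show ?case by (simp add: one_mat2_def)
next
  case (step2 i)
  then show ?case by (simp add: one_mat2_def)
qed

lemma det2_mult [simp]: "det2 (A * B) = det2 A * det2 B"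
  by (cases A; cases B; simp add: algebra_simps)

lemma det2_one [simp]: "det2 1 = 1"
  by (simp add: one_mat2_def)

lemma adj2_left: "adj2 A * A = of_int (det2 A)"
  and adj2_right: "A * adj2 A = of_int (det2 A)"
  by (cases A; simp add: of_int_mat2 algebra_simps)+

lemma det2_adj2 [simp]: "det2 (adj2 A) = det2 A"
  by (cases A; simp add: algebra_simps)

lemma tr2_mult_commute: "tr2 (A * B) = tr2 (B * A)"
  by (cases A; cases B; simp add: algebra_simps)

definition SL2 :: "mat2 monoid" where
  "SL2 = \<lparr>carrier = {A. det2 A = 1}, monoid.mult = (*), one = 1\<rparr>"

lemma SL2_simps [simp]:
  "A \<in> carrier SL2 \<longleftrightarrow> det2 A = 1" "A \<otimes>\<^bsub>SL2\<^esub> B = A * B" "\<one>\<^bsub>SL2\<^esub> = 1"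
  by (simp_all add: SL2_def)

interpretation SL2: group SL2
proof (rule groupI)
  fix A assume "A \<in> carrier SL2"
  then show "\<exists>B\<in>carrier SL2. B \<otimes>\<^bsub>SL2\<^esub> A = \<one>\<^bsub>SL2\<^esub>"
    by (intro bexI[of _ "adj2 A"]) (simp_all add: adj2_left)
qed (simp_all add: mult.assoc)

lemma inv_SL2 [simp]: "det2 A = 1 \<Longrightarrow> inv\<^bsub>SL2\<^esub> A = adj2 A"
  by (rule SL2.inv_equality) (simp_all add: adj2_left)

lemma scalar2_central: "scalar2 A \<Longrightarrow> A * B = B * A"
  by (cases A; cases B; simp add: algebra_simps)

lemma adj2_adj2 [simp]: "adj2 (adj2 A) = A"
  by (cases A) simp

lemma scalar2_conj:
  assumes "det2 C = 1"
  shows "scalar2 (C * A * adj2 C) \<longleftrightarrow> scalar2 A"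
proof -
  have *: "scalar2 (C * A * adj2 C)" if "scalar2 A" "det2 C = 1" for A C
    using that scalar2_central[of A "adj2 C"] adj2_right[of C] by (simp add: mult.assoc) (simp flip: mult.assoc)
  \<comment> \<open>The converse is the same implication for conjugation by the inverse
    \<open>adj2 C\<close>, which undoes the first conjugation.\<close>
  have "adj2 C * (C * A * adj2 C) * adj2 (adj2 C) = (adj2 C * C) * A * (adj2 C * C)"
    by (simp add: mult.assoc)
  also have "\<dots> = A" using assms by (simp add: adj2_left)
  finally show ?thesis using *[of A C] *[of "C * A * adj2 C" "adj2 C"] assms by auto
qed

text \<open>Scalar parts commute with everything, so only (b, c, d - a) and (q, r, s - p) matter:
  the three equations are the vanishing of the 2 by 2 minors of these vectors, that is, their
  parallelism.\<close>

lemma mat2_commute_iff: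
  "Mat a b c d * Mat p q r s = Mat p q r s * Mat a b c d \<longleftrightarrow>
    b * r = c * q \<and> b * (s - p) = q * (d - a) \<and> c * (s - p) = r * (d - a)"
proof -
  have "a * p + b * r = p * a + q * c \<longleftrightarrow> b * r = c * q"
    "a * q + b * s = p * b + q * d \<longleftrightarrow> b * (s - p) = q * (d - a)"
    "c * p + d * r = r * a + s * c \<longleftrightarrow> c * (s - p) = r * (d - a)"
    "c * q + d * s = r * b + s * d \<longleftrightarrow> b * r = c * q"
    by algebra+
  then show ?thesis unfolding times_mat2.simps mat2.inject by blast
qed

text \<open>A non-scalar \<open>M\<close> has a nonzero vector (b, c, d - a), and two vectors
  parallel to the same nonzero vector are parallel to each other.\<close>

lemma commute_nonscalar2:
  assumes "\<not> scalar2 M" "M * A = A * M" "M * B = B * M"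
  shows "A * B = B * A"
proof -
  obtain a b c d where M: "M = Mat a b c d" by (cases M)
  obtain p q r s where A: "A = Mat p q r s" by (cases A)
  obtain p' q' r' s' where B: "B = Mat p' q' r' s'" by (cases B)
  have "b \<noteq> 0 \<or> c \<noteq> 0 \<or> d - a \<noteq> 0" using assms(1) unfolding M by auto
  moreover have "b * r = c * q" "b * (s - p) = q * (d - a)" "c * (s - p) = r * (d - a)"
    "b * r' = c * q'" "b * (s' - p') = q' * (d - a)" "c * (s' - p') = r' * (d - a)"
    using assms(2,3) unfolding M A B mat2_commute_iff by blast+
  ultimately have "q * r' = r * q'" "q * (s' - p') = q' * (s - p)" "r * (s' - p') = r' * (s - p)"
    by algebra+
  then show ?thesis unfolding A B mat2_commute_iff by blast
qed

section \<open>Braid relations between matrices of determinant one\<close>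

lemma braid_commute_mat2:
  assumes "A * B * A = B * A * B" "A * B = B * A" "det2 A = 1" "det2 B = 1"
  shows "A = B"
proof -
  have "A * B * A = A * B * B" using assms(1,2) by (simp add: mult.assoc)
  then have "adj2 (A * B) * (A * B) * A = adj2 (A * B) * (A * B) * B"
    by (simp add: mult.assoc)
  then show ?thesis using assms(3,4) by (simp add: adj2_left)
qed

text \<open>For distinct \<open>X\<close>, \<open>Y\<close> the Cayley--Hamilton theorem turns the braid relation into
  \<open>(tr(XY) - 1)(X - Y) = 0\<close>.\<close>

lemma braid_tr2:
  assumes "det2 X = 1" "det2 Y = 1" "X * Y * X = Y * X * Y"
  shows "tr2 X = tr2 Y" "X \<noteq> Y \<Longrightarrow> tr2 (X * Y) = 1"
proof -
  let ?t = "tr2 Y" and ?\<tau> = "tr2 (X * Y)"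
  \<comment> \<open>The braid relation reads (XY)X = Y(XY), so \<open>X\<close> and \<open>Y\<close>
    are conjugate and have the same trace.\<close>
  have "X = (adj2 (X * Y) * (X * Y)) * X"
    using assms by (simp add: adj2_left)
  also have "\<dots> = adj2 (X * Y) * (Y * X * Y)"
    unfolding assms(3)[symmetric] by (simp only: mult.assoc)
  finally have "tr2 X = tr2 (adj2 (X * Y) * (Y * X * Y))" by (rule arg_cong)
  also have "\<dots> = tr2 (Y * ((X * Y) * adj2 (X * Y)))"
    by (subst tr2_mult_commute) (simp only: mult.assoc)
  also have "\<dots> = tr2 Y" using assms by (simp add: adj2_right)
  finally show t: "tr2 X = tr2 Y" .
  \<comment> \<open>This is the Cayley-Hamilton equation of \<open>A * B\<close>, multiplied on the
    right by the inverse of \<open>B\<close>.\<close>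
  have CH: "A * B * A = of_int (tr2 (A * B)) * A - of_int (det2 A) * adj2 B" for A B
    by (cases A; cases B; simp add: of_int_mat2 algebra_simps)
  have "of_int ?\<tau> * X - adj2 Y = of_int ?\<tau> * Y - adj2 X"
    using CH[of X Y] CH[of Y X] assms by (simp add: tr2_mult_commute[of Y X])
  \<comment> \<open>Since \<open>adj2 X\<close> is tr X - X, equal traces turn the difference of the
    adjugates into X - Y; the four entries then show this.\<close>
  then have "(?\<tau> - 1 = 0) \<or> X = Y" using t
  proof (cases X; cases Y)
    fix a b c d a' b' c' d'
    assume e: "X = Mat a b c d" "Y = Mat a' b' c' d'"
      and "of_int ?\<tau> * X - adj2 Y = of_int ?\<tau> * Y - adj2 X" "tr2 X = tr2 Y"
    then have "of_int ?\<tau> * Mat a b c d - adj2 (Mat a' b' c' d')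
        = of_int ?\<tau> * Mat a' b' c' d' - adj2 (Mat a b c d)" "a + d = a' + d'"
      by simp_all
    then have "?\<tau> * a - d' = ?\<tau> * a' - d" "?\<tau> * b + b' = ?\<tau> * b' + b"
      "?\<tau> * c + c' = ?\<tau> * c' + c" "?\<tau> * d - a' = ?\<tau> * d' - a" "a + d = a' + d'"
      by (simp_all del: e add: of_int_mat2)
    then have "(?\<tau> - 1) * (a - a') = 0" "(?\<tau> - 1) * (b - b') = 0"
      "(?\<tau> - 1) * (c - c') = 0" "(?\<tau> - 1) * (d - d') = 0"
      by algebra+
    then show ?thesis unfolding e by auto
  qed
  then show "?\<tau> = 1" if "X \<noteq> Y" using that by simp
qed

text \<open>If \<open>X\<close> is not scalar, its centralizer consists of the \<open>Z\<close> with \<open>mZ = pX + q\<close>. Taking traces of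
  this and of its product with \<open>Y\<close> gives \<open>q = 0\<close> or \<open>(tr X)\<^sup>2 = 2\<close>.\<close>

lemma braid4_mat2_eq:
  assumes det: "det2 X = 1" "det2 Y = 1" "det2 Z = 1"
    and braid: "X * Y * X = Y * X * Y" "Z * Y * Z = Y * Z * Y" and comm: "X * Z = Z * X"
  shows "X = Z"
\<comment> \<open>The value 1 for the traces of XY and ZY requires distinct factors. If
  \<open>Y\<close> equals one of \<open>X\<close>, \<open>Z\<close>, then it commutes with the other
  and the braid relation collapses.\<close>
proof (cases "X = Y \<or> Z = Y")
  case True
  then show ?thesis
  proof
    assume "X = Y"
    then show ?thesis using braid_commute_mat2[OF braid(2) _ det(3,2)] comm by simp
  next
    assume "Z = Y"
    then show ?thesis using braid_commute_mat2[OF braid(1) _ det(1,2)] comm by simp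
  qed
next
  case False
  then have tr: "tr2 X = tr2 Y" "tr2 (X * Y) = 1" "tr2 Z = tr2 Y" "tr2 (Z * Y) = 1"
    using braid_tr2[OF det(1,2) braid(1)] braid_tr2[OF det(3,2) braid(2)] by simp_all
  \<comment> \<open>A scalar \<open>X\<close> would commute with \<open>Y\<close>, and the braid
    relation would give X = Y.\<close>
  have "\<not> scalar2 X"
    using scalar2_central[of X Y] braid_commute_mat2[of X Y] False det braid by blast
  obtain a b c d where X: "X = Mat a b c d" by (cases X)
  obtain e f g h where Z: "Z = Mat e f g h" by (cases Z)
  have r: "b * g = c * f" "b * (h - e) = f * (d - a)" "c * (h - e) = g * (d - a)"
    using comm unfolding X Z mat2_commute_iff by blast+
  \<comment> \<open>\<open>m\<close> is a nonzero number among \<open>b\<close>, \<open>c\<close>,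
    \<open>d - a\<close>, \<open>p\<close> is the corresponding number for \<open>Z\<close>, and
    \<open>q\<close> is read off the upper left entry.\<close>
  obtain m p q where m: "m \<noteq> 0" and mZ: "of_int m * Z = of_int p * X + of_int q"
  proof -
    have "b \<noteq> 0 \<or> c \<noteq> 0 \<or> d - a \<noteq> 0" using \<open>\<not> scalar2 X\<close> unfolding X by auto
    then consider "b \<noteq> 0" | "c \<noteq> 0" | "d - a \<noteq> 0" by blast
    then show thesis
    proof cases
      case 1
      have "of_int b * Z = of_int f * X + of_int (b * e - f * a)"
        using r(1,2) unfolding X Z of_int_mat2 by (simp add: algebra_simps)
      with 1 that show thesis by blast
    next
      case 2
      have "of_int c * Z = of_int g * X + of_int (c * e - g * a)"
        using r(1,3) unfolding X Z of_int_mat2 by (simp add: algebra_simps)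
      with 2 that show thesis by blast
    next
      case 3
      have "of_int (d - a) * Z = of_int (h - e) * X + of_int ((d - a) * e - (h - e) * a)"
        using r(2,3) unfolding X Z of_int_mat2 by (simp add: algebra_simps)
      with 3 that show thesis by blast
    qed
  qed
  have tr_lin: "tr2 (A + B) = tr2 A + tr2 B" "tr2 (of_int k * A) = k * tr2 A"
    "tr2 (of_int k) = 2 * k" for A B k
    by (cases A; cases B; simp add: of_int_mat2 algebra_simps)+
  have 1: "m * tr2 Y = p * tr2 Y + 2 * q"
    using arg_cong[OF mZ, of tr2] tr by (simp add: tr_lin)
  have "of_int m * (Z * Y) = of_int p * (X * Y) + of_int q * Y"
    using arg_cong[OF mZ, of "\<lambda>A. A * Y"] by (simp add: distrib_right mult.assoc)
  from arg_cong[OF this, of tr2] have 2: "m = p + q * tr2 Y"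
    using tr by (simp add: tr_lin)
  have "q * (tr2 Y * tr2 Y - 2) = 0" using 1 unfolding 2 by algebra
  moreover have "t * t \<noteq> (2::int)" for t
  proof
    assume "t * t = 2"
    then have u: "\<bar>t\<bar> * \<bar>t\<bar> = 2" by simp
    moreover have "\<bar>t\<bar> \<noteq> 0" "\<bar>t\<bar> \<noteq> 1" using u by (intro notI; simp only:; simp)+
    then have "2 \<le> \<bar>t\<bar>" by linarith
    then have "2 * 2 \<le> \<bar>t\<bar> * \<bar>t\<bar>" by (intro mult_mono) auto
    ultimately show False by simp
  qed
  ultimately have "q = 0" by auto
  with 2 mZ m have "of_int m * Z = of_int m * X" by simp
  with m show ?thesis by (cases X; cases Z; simp add: of_int_mat2)
qed

section \<open>Normal forms in the modular group\<close>

text \<open>The intended instance is the quotient of the three-strand braid group by its centre, where the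
  positive letters \<open>\<sigma>\<^sub>1\<^sup>-\<^sup>1\<close> and \<open>\<sigma>\<^sub>2\<close> are \<open>\<beta>\<alpha>\<close> and \<open>\<beta>\<alpha>\<^sup>2\<close>.\<close>

locale modular_group = group +
  fixes f :: "nat \<Rightarrow> 'a" and a b
  assumes a: "a \<in> carrier G" and b: "b \<in> carrier G"
    and a3: "a \<otimes> a \<otimes> a = \<one>" and b2: "b \<otimes> b = \<one>"
    and f1: "f 1 = a \<otimes> a \<otimes> b" and f2: "f 2 = b \<otimes> a \<otimes> a"
begin

abbreviation "pos \<equiv> {(1::nat, False), (2, True)}"

section \<open>Positive words in the modular group\<close>

lemma modular_simps:
  shows "a \<otimes> (a \<otimes> a) = \<one>"
    and "x \<in> carrier G \<Longrightarrow> a \<otimes> (a \<otimes> (a \<otimes> x)) = x"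
    and "x \<in> carrier G \<Longrightarrow> b \<otimes> (b \<otimes> x) = x"
proof -
  show "a \<otimes> (a \<otimes> a) = \<one>" using a3 a by (simp add: m_assoc)
  show "a \<otimes> (a \<otimes> (a \<otimes> x)) = x" if "x \<in> carrier G"
  proof -
    have "a \<otimes> (a \<otimes> (a \<otimes> x)) = a \<otimes> a \<otimes> a \<otimes> x" using a that by (simp only: m_assoc m_closed)
    then show ?thesis using that by (simp add: a3)
  qed
  show "b \<otimes> (b \<otimes> x) = x" if "x \<in> carrier G"
    using that b b2 by (simp flip: m_assoc)
qed

lemma modular_inv: "inv a = a \<otimes> a" "inv b = b" "inv (f 1) = b \<otimes> a"
proof -
  show i: "inv a = a \<otimes> a" "inv b = b" using a b a3 b2 by (intro inv_equality; simp)+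
  show "inv (f 1) = b \<otimes> a"
    using a b modular_simps by (intro inv_equality) (simp_all add: f1 m_assoc b2 del: One_nat_def)
qed

lemma f_closed: "f ` {1, 2} \<subseteq> carrier G"
  using a b by (simp add: f1 f2 del: One_nat_def)

lemma pos_closed [simp]: "set w \<subseteq> pos \<Longrightarrow> word_value G f w \<in> carrier G"
  by (rule word_value_closed[of _ "{1, 2}"]) (use f_closed in auto)

lemma pos_append:
  assumes "set u \<subseteq> pos" "set v \<subseteq> pos"
  shows "word_value G f (u @ v) = word_value G f u \<otimes> word_value G f v"
  by (rule word_value_append[of _ "{1, 2}"]) (use f_closed assms in auto)

lemma pos_Cons:
  "word_value G f ((1, False) # w) = b \<otimes> a \<otimes> word_value G f w"
  "word_value G f ((2, True) # w) = b \<otimes> a \<otimes> a \<otimes> word_value G f w"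
  by (simp_all add: modular_inv(3) f2 del: One_nat_def)

text \<open>Each positive letter is a syllable b x with x = a or x = a a. Exposing the first
  syllable lets an adjacent \<open>b\<close> cancel.\<close>

lemma pos_cases:
  assumes "set w \<subseteq> pos"
  obtains "w = []" | w' x where "set w' \<subseteq> pos" "x = a \<or> x = a \<otimes> a"
    "word_value G f w = b \<otimes> x \<otimes> word_value G f w'" "length w = Suc (length w')"
  using assms
proof (cases w)
  case (Cons p w')
  then have w': "set w' \<subseteq> pos" and "p = (1, False) \<or> p = (2, True)" using assms by auto
  then have "word_value G f w = b \<otimes> a \<otimes> word_value G f w' \<or>
      word_value G f w = b \<otimes> (a \<otimes> a) \<otimes> word_value G f w'"
    using Cons a b by (auto simp only: pos_Cons m_assoc m_closed pos_closed)
  then show ?thesis using that(2)[OF w'] Cons by auto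
qed (use that in auto)

lemma pos_rev_cases:
  assumes "set w \<subseteq> pos"
  obtains "w = []" | w' x where "set w' \<subseteq> pos" "x = a \<or> x = a \<otimes> a"
    "word_value G f w = word_value G f w' \<otimes> (b \<otimes> x)" "length w = Suc (length w')"
  using assms
proof (cases w rule: rev_cases)
  case (snoc w' p)
  then have "p = (1, False) \<or> p = (2, True)" and w': "set w' \<subseteq> pos" using assms by auto
  then have "word_value G f [p] = b \<otimes> a \<or> word_value G f [p] = b \<otimes> (a \<otimes> a)"
    using a b pos_Cons[of "[]"] by (auto simp del: word_value.simps(2) simp: m_assoc)
  moreover have "word_value G f w = word_value G f w' \<otimes> word_value G f [p]"
    using snoc assms by (simp only: pos_append set_append Un_subset_iff)
  moreover have "length w = Suc (length w')" using snoc by simp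
  ultimately show ?thesis using that(2)[OF w', of a] that(2)[OF w', of "a \<otimes> a"] by metis
qed (use that in auto)

text \<open>The shape of an alternating word in a free product of cyclic groups of orders 3 and 2:
  an optional power of \<open>a\<close>, then syllables b a or b a a recorded as a positive word,
  then an optional final \<open>b\<close>.\<close>

definition reduced where
  "reduced x w y \<longleftrightarrow> (x = \<one> \<or> x = a \<or> x = a \<otimes> a) \<and> set w \<subseteq> pos \<and> (y = \<one> \<or> y = b)"

lemma reduced_closed:
  "reduced x w y \<Longrightarrow> x \<in> carrier G" "reduced x w y \<Longrightarrow> y \<in> carrier G"
  "reduced x w y \<Longrightarrow> word_value G f w \<in> carrier G"
  using a b by (auto simp: reduced_def)

definition has_reduced where
  "has_reduced g \<longleftrightarrow> (\<exists>x w y. reduced x w y \<and> g = x \<otimes> (word_value G f w \<otimes> y))"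

lemma has_reduced_a:
  assumes "has_reduced g"
  shows "has_reduced (a \<otimes> g)"
proof -
  obtain x w y where r: "reduced x w y" and g: "g = x \<otimes> (word_value G f w \<otimes> y)"
    using assms by (auto simp: has_reduced_def)
  note c = reduced_closed[OF r]
  have "reduced (a \<otimes> x) w y"
    using r a3 a by (auto simp: reduced_def m_assoc)
  moreover have "a \<otimes> g = (a \<otimes> x) \<otimes> (word_value G f w \<otimes> y)"
    using a c by (simp add: g m_assoc)
  ultimately show ?thesis unfolding has_reduced_def by blast
qed

text \<open>If the leading power of \<open>a\<close> is nontrivial, \<open>b\<close> joins it to
  form a new positive letter. If it is trivial, \<open>b\<close> cancels against the first letter
  and releases a power of \<open>a\<close>, or it meets \<open>y\<close> when the word is
  empty.\<close>

lemma has_reduced_b: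
  assumes "has_reduced g"
  shows "has_reduced (b \<otimes> g)"
proof -
  obtain x w y where r: "reduced x w y" and g: "g = x \<otimes> (word_value G f w \<otimes> y)"
    using assms by (auto simp: has_reduced_def)
  note c = reduced_closed[OF r]
  have w: "set w \<subseteq> pos" and y: "y = \<one> \<or> y = b" using r by (auto simp: reduced_def)
  from r consider "x = \<one>" | "x = a" | "x = a \<otimes> a" by (auto simp: reduced_def)
  then show ?thesis
  proof cases
    case 1
    from w show ?thesis
    proof (cases rule: pos_cases)
      case 1
      have "b \<otimes> g = \<one> \<otimes> (word_value G f [] \<otimes> (b \<otimes> y))"
        using b c by (simp add: g 1 \<open>x = \<one>\<close>)
      moreover have "reduced \<one> [] (b \<otimes> y)" using y b b2 by (auto simp: reduced_def)
      ultimately show ?thesis unfolding has_reduced_def by blast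
    next
      case (2 w' x')
      then have "x' \<in> carrier G" using a by auto
      then have "b \<otimes> g = x' \<otimes> (word_value G f w' \<otimes> y)"
        using b c 2 by (simp add: g \<open>x = \<one>\<close> m_assoc modular_simps)
      moreover have "reduced x' w' y" using 2 r by (auto simp: reduced_def)
      ultimately show ?thesis unfolding has_reduced_def by blast
    qed
  next
    case 2
    have "b \<otimes> g = \<one> \<otimes> (word_value G f ((1, False) # w) \<otimes> y)"
      using a b c unfolding pos_Cons by (simp add: g 2 m_assoc)
    moreover have "reduced \<one> ((1, False) # w) y" using r by (simp add: reduced_def)
    ultimately show ?thesis unfolding has_reduced_def by blast
  next
    case 3
    have "b \<otimes> g = \<one> \<otimes> (word_value G f ((2, True) # w) \<otimes> y)"
      using a b c unfolding pos_Cons by (simp add: g 3 m_assoc)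
    moreover have "reduced \<one> ((2, True) # w) y" using r by (simp add: reduced_def)
    ultimately show ?thesis unfolding has_reduced_def by blast
  qed
qed

text \<open>All generators and their inverses are products of \<open>a\<close> and \<open>b\<close>
  alone, so left multiplication by these two handles every letter.\<close>

lemma has_reduced_word:
  assumes "set w \<subseteq> {1, 2} \<times> UNIV"
  shows "has_reduced (word_value G f w)"
  using assms
proof (induction w)
  case Nil
  have "reduced \<one> [] \<one>" by (simp add: reduced_def)
  then show ?case unfolding has_reduced_def by force
next
  case (Cons p w)
  let ?v = "word_value G f w"
  have r: "has_reduced ?v" and p: "p \<in> {1, 2} \<times> UNIV" and w: "set w \<subseteq> {1, 2} \<times> UNIV"
    using Cons by auto
  have v: "?v \<in> carrier G" using word_value_closed[OF w f_closed] .
  have i2: "inv (f 2) = a \<otimes> b"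
    using a b modular_inv by (simp add: f2 inv_mult_group m_assoc[symmetric] modular_simps)
      (simp add: m_assoc modular_simps)
  have i1: "inv (f 1) = b \<otimes> a" by (rule modular_inv)
  have "word_value G f (p # w) \<in> {f 1 \<otimes> ?v, f 2 \<otimes> ?v, inv (f 1) \<otimes> ?v, inv (f 2) \<otimes> ?v}"
    using p by auto
  then have "word_value G f (p # w) \<in> {a \<otimes> (a \<otimes> (b \<otimes> ?v)), b \<otimes> (a \<otimes> (a \<otimes> ?v)), b \<otimes> (a \<otimes> ?v), a \<otimes> (b \<otimes> ?v)}"
    unfolding i1 i2 unfolding f1 f2 using v a b by (simp only: m_assoc m_closed)
  then show ?case using r has_reduced_a has_reduced_b by auto
qed

section \<open>Representatives of the conjugacy classes\<close>

definition cyc_reduced where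
  "cyc_reduced c \<longleftrightarrow> c \<in> {\<one>, a, inv a, b} \<or> (\<exists>w. set w \<subseteq> pos \<and> w \<noteq> [] \<and> c = word_value G f w)"

lemma conj_conj:
  assumes "h \<in> carrier G" "k \<in> carrier G" "c \<in> carrier G" "g = h \<otimes> (k \<otimes> c \<otimes> inv k) \<otimes> inv h"
  shows "g = (h \<otimes> k) \<otimes> c \<otimes> inv (h \<otimes> k)"
  using assms by (simp add: inv_mult_group m_assoc)

text \<open>Conjugation carries one end of the reduced form to the other. There the ends either
  merge into a positive word or cancel and shorten \<open>w\<close>; cancellation may change
  \<open>x\<close> and \<open>y\<close>, so the induction on the length keeps them
  arbitrary.\<close>

lemma reduced_conj:
  assumes "reduced x w y"
  shows "\<exists>h\<in>carrier G. \<exists>c\<in>carrier G. cyc_reduced c \<and> x \<otimes> (word_value G f w \<otimes> y) = h \<otimes> c \<otimes> inv h"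
  using assms
proof (induction "length w" arbitrary: x w y rule: less_induct)
  case less
  note r = less.prems
  note c = reduced_closed[OF r]
  let ?g = "x \<otimes> (word_value G f w \<otimes> y)"
  let ?P = "\<lambda>g. \<exists>h\<in>carrier G. \<exists>c\<in>carrier G. cyc_reduced c \<and> g = h \<otimes> c \<otimes> inv h"
  have w: "set w \<subseteq> pos" using r by (simp add: reduced_def)
  have conjP: "?P g" if "g = h \<otimes> g' \<otimes> inv h" "h \<in> carrier G" "?P g'" for g g' h
    using that conj_conj by (metis m_closed)
  have doneP: "?P g" if "cyc_reduced g" "g \<in> carrier G" for g
    using that by (intro bexI[of _ \<one>] bexI[of _ g]) auto
  have shorter: "?P (x' \<otimes> (word_value G f w' \<otimes> y'))"
    if "reduced x' w' y'" "length w' < length w" for x' w' y'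
    using less.hyps that by blast
  have pos: "?P (word_value G f v)" if "set v \<subseteq> pos" "v \<noteq> []" for v
    using that by (intro doneP) (auto simp only: cyc_reduced_def pos_closed)
  have pos1: "?P (b \<otimes> a \<otimes> word_value G f w)" "?P (b \<otimes> a \<otimes> a \<otimes> word_value G f w)"
    using pos[of "(1, False) # w"] pos[of "(2, True) # w"] w unfolding pos_Cons by simp_all
  from r consider "x = \<one>" "y = \<one>" | "x \<noteq> \<one>" "y = \<one>" | "x = \<one>" "y = b" | "x \<noteq> \<one>" "y = b"
    by (auto simp: reduced_def)
  then show ?case
  proof cases
    case 1
    have "?P (word_value G f w)"
      by (cases "w = []") (use pos[OF w] doneP in \<open>auto simp: cyc_reduced_def\<close>)
    then show ?thesis using 1 c by simp
  next
    case 2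
    then have x: "x = a \<or> x = a \<otimes> a" using r by (auto simp: reduced_def)
    from w show ?thesis
    proof (cases rule: pos_rev_cases)
      case 1
      then have "?g = x" using 2 c by simp
      then show ?thesis using x a doneP by (auto simp: cyc_reduced_def modular_inv)
    next
      case (2 w' x')
      let ?v = "word_value G f w'"
      have x': "x' \<in> carrier G" and v: "?v \<in> carrier G" using 2 a by auto
      \<comment> \<open>Moving \<open>x\<close> to the end lets it meet the last power
        \<open>x'\<close>. If they cancel, a shorter word with final \<open>b\<close> remains;
        otherwise a times a completes the letter b a a, and the fourth power of \<open>a\<close> is
        \<open>a\<close>, completing the letter b a.\<close>
      have "?g = x \<otimes> (?v \<otimes> (b \<otimes> (x' \<otimes> x))) \<otimes> inv x"
        using 2 \<open>y = \<one>\<close> c x' v b by (simp add: m_assoc)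
      moreover have "?P (?v \<otimes> (b \<otimes> (x' \<otimes> x)))"
      proof -
        from x 2(2) consider "x' \<otimes> x = \<one>" | "x = a" "x' = a" | "x = a \<otimes> a" "x' = a \<otimes> a"
          using a a3 by (auto simp: m_assoc)
        then show ?thesis
        proof cases
          case 1
          then show ?thesis using shorter[of \<one> w' b] 2 v b by (simp add: reduced_def)
        next
          case 2
          have "?v \<otimes> (b \<otimes> (x' \<otimes> x)) = word_value G f (w' @ [(2, True)])"
            using \<open>set w' \<subseteq> pos\<close> pos_Cons(2)[of "[]"] a b 2 by (simp add: pos_append m_assoc)
          then show ?thesis using pos[of "w' @ [(2, True)]"] \<open>set w' \<subseteq> pos\<close> by simp
        next
          case 3
          have "?v \<otimes> (b \<otimes> (x' \<otimes> x)) = word_value G f (w' @ [(1, False)])"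
            using \<open>set w' \<subseteq> pos\<close> pos_Cons(1)[of "[]"] a b 3
            by (simp add: pos_append m_assoc modular_simps del: One_nat_def)
          then show ?thesis using pos[of "w' @ [(1, False)]"] \<open>set w' \<subseteq> pos\<close> by simp
        qed
      qed
      ultimately show ?thesis using conjP c by blast
    qed
  next
    case 3
    \<comment> \<open>The final \<open>b\<close> moves to the front, where it cancels the
      \<open>b\<close> of the first letter.\<close>
    have "?g = b \<otimes> (b \<otimes> word_value G f w) \<otimes> inv b"
      using 3 b c by (simp add: modular_inv m_assoc modular_simps)
    moreover have "?P (b \<otimes> word_value G f w)"
      using w
    proof (cases rule: pos_cases)
      case 1
      then show ?thesis using b doneP[of b] by (simp add: cyc_reduced_def)
    next
      case (2 w' x')
      then have "x' \<in> carrier G" using a by auto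
      then show ?thesis using shorter[of x' w' \<one>] 2 b
        by (simp add: reduced_def m_assoc modular_simps)
    qed
    ultimately show ?thesis using conjP b by blast
  next
    case 4
    \<comment> \<open>Cyclic rotation brings the final \<open>b\<close> in front of the nontrivial
      \<open>x\<close>, and b x is a positive letter.\<close>
    have "?g = (x \<otimes> word_value G f w) \<otimes> (b \<otimes> x \<otimes> word_value G f w) \<otimes> inv (x \<otimes> word_value G f w)"
      using 4 b c by (simp add: m_assoc)
    moreover have "?P (b \<otimes> x \<otimes> word_value G f w)"
    proof -
      have "x = a \<or> x = a \<otimes> a" using 4 r by (auto simp: reduced_def)
      then have "b \<otimes> x = b \<otimes> a \<or> b \<otimes> x = b \<otimes> a \<otimes> a" using a b by (auto simp: m_assoc)
      then show ?thesis using pos1 by metis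
    qed
    ultimately show ?thesis using conjP c by blast
  qed
qed

lemma cyc_reduced_conj:
  assumes "set w \<subseteq> {1, 2} \<times> UNIV"
  shows "\<exists>h\<in>carrier G. \<exists>c\<in>carrier G. cyc_reduced c \<and> word_value G f w = h \<otimes> c \<otimes> inv h"
proof -
  obtain x v y where "reduced x v y" "word_value G f w = x \<otimes> (word_value G f v \<otimes> y)"
    using has_reduced_word[OF assms] unfolding has_reduced_def by blast
  with reduced_conj[of x v y] show ?thesis by simp
qed

end

section \<open>Structure of the three-strand braid group\<close>

interpretation B3: group "braid_group 3" by (rule group_braid_group)

abbreviation braid3_mult (infixl "\<cdot>" 70) where "x \<cdot> y \<equiv> x \<otimes>\<^bsub>braid_group 3\<^esub> y"
abbreviation braid3_inv where "braid3_inv x \<equiv> inv\<^bsub>braid_group 3\<^esub> x"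

section \<open>The full twist and its powers\<close>

definition zeta :: "nat word set" where "zeta = beta \<cdot> beta"

abbreviation zeta_pow :: "int \<Rightarrow> nat word set" where
  "zeta_pow k \<equiv> zeta [^]\<^bsub>braid_group 3\<^esub> k"

lemma gen_closed [simp]: "artin 3 1 \<in> carrier (braid_group 3)" "artin 3 2 \<in> carrier (braid_group 3)"
  by (simp_all add: artin_closed)

lemma elem_closed [simp]:
  "alpha \<in> carrier (braid_group 3)" "beta \<in> carrier (braid_group 3)" "zeta \<in> carrier (braid_group 3)"
  by (simp_all add: alpha_def beta_def zeta_def del: One_nat_def)

lemma artin3_braid: "artin 3 1 \<cdot> artin 3 2 \<cdot> artin 3 1 = artin 3 2 \<cdot> artin 3 1 \<cdot> artin 3 2"
  using artin_braid[of 1 3] by (simp add: numeral_2_eq_2)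

lemma alpha_artin: "alpha \<cdot> artin 3 1 = beta" "artin 3 2 \<cdot> alpha = beta"
  using artin3_braid by (simp_all add: alpha_def beta_def B3.m_assoc del: One_nat_def)

lemma alpha_cubed: "alpha \<cdot> alpha \<cdot> alpha = zeta"
proof -
  have "alpha \<cdot> alpha \<cdot> alpha = (alpha \<cdot> artin 3 1) \<cdot> (artin 3 2 \<cdot> alpha)"
    by (simp add: alpha_def B3.m_assoc del: One_nat_def)
  then show ?thesis by (simp only: alpha_artin zeta_def)
qed

lemma (in group) commute_inv:
  assumes "x \<in> carrier G" "c \<in> carrier G" "c \<otimes> x = x \<otimes> c"
  shows "c \<otimes> inv x = inv x \<otimes> c"
proof -
  have "inv x \<otimes> (c \<otimes> x) \<otimes> inv x = inv x \<otimes> (x \<otimes> c) \<otimes> inv x" by (simp only: assms(3))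
  moreover have "inv x \<otimes> (c \<otimes> x) \<otimes> inv x = inv x \<otimes> c" using assms(1,2) by (simp add: m_assoc)
  moreover have "inv x \<otimes> (x \<otimes> c) \<otimes> inv x = c \<otimes> inv x"
    using assms(1,2) by (simp flip: m_assoc)
  ultimately show ?thesis by simp
qed

lemma (in group) word_value_commute:
  assumes "set w \<subseteq> S \<times> UNIV" "f ` S \<subseteq> carrier G" "c \<in> carrier G"
    and "\<And>x. x \<in> S \<Longrightarrow> c \<otimes> f x = f x \<otimes> c"
  shows "c \<otimes> word_value G f w = word_value G f w \<otimes> c"
  using assms(1)
proof (induction w)
  case Nil
  then show ?case using assms by simp
next
  case (Cons p w)
  then have x: "fst p \<in> S" and w: "set w \<subseteq> S \<times> UNIV" by auto
  let ?g = "if snd p then f (fst p) else inv f (fst p)" and ?v = "word_value G f w"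
  have f: "f (fst p) \<in> carrier G" using x assms(2) by auto
  have "c \<otimes> inv (f (fst p)) = inv (f (fst p)) \<otimes> c"
    by (rule commute_inv[OF f assms(3) assms(4)[OF x]])
  then have g: "c \<otimes> ?g = ?g \<otimes> c" "?g \<in> carrier G" using assms(4)[OF x] f by auto
  have v: "?v \<in> carrier G" using w assms(2) by (rule word_value_closed)
  have "c \<otimes> (?g \<otimes> ?v) = c \<otimes> ?g \<otimes> ?v" by (rule m_assoc[OF assms(3) g(2) v, symmetric])
  also have "\<dots> = ?g \<otimes> (c \<otimes> ?v)" unfolding g(1) by (rule m_assoc[OF g(2) assms(3) v])
  also have "\<dots> = ?g \<otimes> ?v \<otimes> c" unfolding Cons.IH[OF w] by (rule m_assoc[OF g(2) v assms(3), symmetric])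
  finally show ?case by simp
qed

lemma braid_class_word_value:
  assumes "set w \<subseteq> {1..<n} \<times> UNIV"
  shows "braid_class n w = word_value (braid_group n) (artin n) w"
proof -
  interpret group "braid_group n" by (rule group_braid_group)
  have "(\<lambda>x. x) \<in> hom (braid_group n) (braid_group n)" by (rule homI) auto
  from hom_braid_class[OF this assms] show ?thesis by simp
qed

text \<open>Conjugation by \<open>beta\<close> interchanges the two Artin generators, so its square
  fixes both; commuting with the generators extends to all words.\<close>

lemma zeta_commute:
  assumes "x \<in> carrier (braid_group 3)"
  shows "zeta \<cdot> x = x \<cdot> zeta"
proof -
  obtain w where w: "x = braid_class 3 w" "set w \<subseteq> {1..<3} \<times> UNIV" using braid_carrierE[OF assms] .
  have b1: "beta \<cdot> artin 3 1 = artin 3 2 \<cdot> beta"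
  proof -
    have "beta \<cdot> artin 3 1 = (artin 3 2 \<cdot> alpha) \<cdot> artin 3 1" by (simp only: alpha_artin)
    also have "\<dots> = artin 3 2 \<cdot> (alpha \<cdot> artin 3 1)"
      by (simp only: B3.m_assoc gen_closed elem_closed)
    finally show ?thesis by (simp only: alpha_artin)
  qed
  have b2: "beta \<cdot> artin 3 2 = artin 3 1 \<cdot> beta"
  proof -
    have "beta \<cdot> artin 3 2 = artin 3 1 \<cdot> (artin 3 2 \<cdot> alpha)"
      by (simp add: beta_def alpha_def B3.m_assoc del: One_nat_def)
    then show ?thesis by (simp only: alpha_artin)
  qed
  have "zeta \<cdot> artin 3 1 = artin 3 1 \<cdot> zeta"
    unfolding zeta_def using b1 b2 by (metis B3.m_assoc elem_closed(2) gen_closed)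
  moreover have "zeta \<cdot> artin 3 2 = artin 3 2 \<cdot> zeta"
    unfolding zeta_def using b1 b2 by (metis B3.m_assoc elem_closed(2) gen_closed)
  moreover have "x = 1 \<or> x = 2" if "x \<in> {1..<3}" for x :: nat using that by auto
  ultimately have "zeta \<cdot> artin 3 x = artin 3 x \<cdot> zeta" if "x \<in> {1..<3}" for x using that by metis
  moreover have "artin 3 ` {1..<3} \<subseteq> carrier (braid_group 3)" using artin_closed by blast
  ultimately show ?thesis
    unfolding w(1) braid_class_word_value[OF w(2)] using w(2)
    by (intro B3.word_value_commute[of w "{1..<3}"]) auto
qed

lemma zeta_pow_commute:
  assumes "x \<in> carrier (braid_group 3)"
  shows "zeta_pow k \<cdot> x = x \<cdot> zeta_pow k"
proof -
  interpret h: group_hom integer_group "braid_group 3" zeta_pow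
    using B3.hom_integer_group_pow[of zeta]
    by (simp add: group_hom_def group_hom_axioms_def group_braid_group)
  have n: "zeta [^]\<^bsub>braid_group 3\<^esub> n \<cdot> x = x \<cdot> zeta [^]\<^bsub>braid_group 3\<^esub> n" for n :: nat
    using B3.group_commutes_pow[OF zeta_commute[OF assms]] assms by simp
  show ?thesis
  proof (cases k rule: int_cases2)
    case (nonneg n)
    then show ?thesis using n by (simp add: int_pow_int)
  next
    case (nonpos n)
    let ?y = "zeta [^]\<^bsub>braid_group 3\<^esub> n"
    have y: "?y \<in> carrier (braid_group 3)" by simp
    have "braid3_inv ?y \<cdot> x = x \<cdot> braid3_inv ?y"
      by (rule B3.commute_inv[OF y assms n[symmetric], symmetric])
    then show ?thesis using nonpos by (simp add: B3.int_pow_neg_int)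
  qed
qed

lemma zeta_pow_center: "zeta_pow k \<in> center (braid_group 3)"
  using zeta_pow_commute by (simp add: center_def centralizer_def)

text \<open>The conjugacy representatives are found in the quotient by the powers of
  \<open>zeta\<close> and lifted. Two elements with the same coset differ by a power of
  \<open>zeta\<close>, which is the factor \<open>zeta_pow k\<close>.\<close>

lemma braid3_normal_form:
  assumes g: "g \<in> carrier (braid_group 3)"
  obtains k h c where "h \<in> carrier (braid_group 3)" "c \<in> carrier (braid_group 3)"
    "g = zeta_pow k \<cdot> (h \<cdot> c \<cdot> braid3_inv h)"
    "c \<in> {\<one>\<^bsub>braid_group 3\<^esub>, alpha, braid3_inv alpha, beta} \<or>
     (\<exists>w. set w \<subseteq> {(1, False), (2, True)} \<and> w \<noteq> [] \<and> c = braid_class 3 w)"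
proof -
  let ?B = "braid_group 3" and ?Z = "range zeta_pow"
  have gen: "?Z = generate ?B {zeta}" by (auto simp: B3.generate_pow)
  have sub: "subgroup ?Z ?B" unfolding gen by (rule B3.generate_is_subgroup) simp
  have N: "?Z \<lhd> ?B"
  proof (rule B3.normal_invI[OF sub])
    fix x h assume "h \<in> ?Z" "x \<in> carrier ?B"
    then show "x \<cdot> h \<cdot> braid3_inv x \<in> ?Z"
      using zeta_pow_commute[symmetric] by (auto simp: B3.m_assoc)
  qed
  interpret N: normal ?Z ?B by (rule N)
  define Q where "Q = ?B Mod ?Z"
  define \<pi> where "\<pi> x = ?Z #>\<^bsub>?B\<^esub> x" for x
  interpret Q: group Q unfolding Q_def by (rule N.factorgroup_is_group)
  have hom: "\<pi> \<in> hom ?B Q" unfolding Q_def \<pi>_def by (rule N.r_coset_hom_Mod)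
  interpret \<pi>: group_hom ?B Q \<pi>
    using hom by (simp add: group_hom_def group_hom_axioms_def group_braid_group Q.is_group)
  have \<pi>E: "\<exists>k. x = zeta_pow k \<cdot> y"
    if "\<pi> x = \<pi> y" "x \<in> carrier ?B" "y \<in> carrier ?B" for x y
  proof -
    have "x \<in> \<pi> x" unfolding \<pi>_def using that sub by (simp add: B3.rcos_self)
    then have "x \<in> ?Z #>\<^bsub>?B\<^esub> y" using that(1) by (simp only: \<pi>_def)
    then show ?thesis unfolding r_coset_def by blast
  qed
  have lift: "\<exists>x\<in>carrier ?B. X = \<pi> x" if "X \<in> carrier Q" for X
    using that unfolding Q_def FactGroup_def RCOSETS_def \<pi>_def by auto
  have \<pi>zeta: "\<pi> zeta = \<one>\<^bsub>Q\<^esub>"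
  proof -
    have "zeta \<in> ?Z" by (rule range_eqI[of _ _ 1]) simp
    then show ?thesis using sub unfolding \<pi>_def Q_def FactGroup_def
      by (simp add: B3.coset_join2)
  qed
  let ?f = "\<lambda>i. \<pi> (artin 3 i)"
  interpret M: modular_group Q ?f "\<pi> alpha" "\<pi> beta"
  proof unfold_locales
    show "\<pi> alpha \<in> carrier Q" "\<pi> beta \<in> carrier Q" by simp_all
    show "\<pi> alpha \<otimes>\<^bsub>Q\<^esub> \<pi> alpha \<otimes>\<^bsub>Q\<^esub> \<pi> alpha = \<one>\<^bsub>Q\<^esub>"
      using \<pi>zeta alpha_cubed by (simp flip: \<pi>.hom_mult)
    show "\<pi> beta \<otimes>\<^bsub>Q\<^esub> \<pi> beta = \<one>\<^bsub>Q\<^esub>"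
      using \<pi>zeta by (simp flip: \<pi>.hom_mult zeta_def)
    \<comment> \<open>The cube of \<open>alpha\<close> dies in the quotient, so this identity and
      the next express the Artin generators through \<open>alpha\<close> and \<open>beta\<close> as
      the locale prescribes.\<close>
    have "alpha \<cdot> alpha \<cdot> beta = alpha \<cdot> alpha \<cdot> alpha \<cdot> artin 3 1"
      by (simp add: alpha_artin(1)[symmetric] B3.m_assoc del: One_nat_def)
    from arg_cong[OF this[unfolded alpha_cubed], of \<pi>]
    show "\<pi> (artin 3 1) = \<pi> alpha \<otimes>\<^bsub>Q\<^esub> \<pi> alpha \<otimes>\<^bsub>Q\<^esub> \<pi> beta"
      by (simp add: \<pi>zeta del: One_nat_def)
    have "beta \<cdot> alpha \<cdot> alpha = artin 3 2 \<cdot> (alpha \<cdot> alpha \<cdot> alpha)"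
      by (simp add: alpha_artin(2)[symmetric] B3.m_assoc del: One_nat_def)
    from arg_cong[OF this[unfolded alpha_cubed], of \<pi>]
    show "\<pi> (artin 3 2) = \<pi> beta \<otimes>\<^bsub>Q\<^esub> \<pi> alpha \<otimes>\<^bsub>Q\<^esub> \<pi> alpha"
      by (simp add: \<pi>zeta del: One_nat_def)
  qed
  have three: "{1..<3::nat} = {1, 2}" by auto
  obtain v where v: "g = braid_class 3 v" "set v \<subseteq> {1, 2} \<times> UNIV"
    using braid_carrierE[OF g] unfolding three by metis
  have cls: "\<pi> (braid_class 3 w) = word_value Q ?f w" if "set w \<subseteq> {1, 2} \<times> UNIV" for w
    using Q.hom_braid_class[OF hom, of w] that unfolding three by simp
  obtain H C where H: "H \<in> carrier Q" and C: "C \<in> carrier Q" "M.cyc_reduced C"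
    and \<pi>g: "\<pi> g = H \<otimes>\<^bsub>Q\<^esub> C \<otimes>\<^bsub>Q\<^esub> inv\<^bsub>Q\<^esub> H"
    using M.cyc_reduced_conj[OF v(2)] cls[OF v(2)] v(1) by metis
  obtain h where h: "h \<in> carrier ?B" "H = \<pi> h" using lift[OF H] by blast
  have "\<exists>c\<in>carrier ?B. C = \<pi> c \<and> (c \<in> {\<one>\<^bsub>?B\<^esub>, alpha, braid3_inv alpha, beta} \<or>
     (\<exists>w. set w \<subseteq> {(1, False), (2, True)} \<and> w \<noteq> [] \<and> c = braid_class 3 w))"
  proof (cases "C \<in> {\<one>\<^bsub>Q\<^esub>, \<pi> alpha, inv\<^bsub>Q\<^esub> \<pi> alpha, \<pi> beta}")
    case True
    then have "C \<in> \<pi> ` {\<one>\<^bsub>?B\<^esub>, alpha, braid3_inv alpha, beta}"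
      using \<pi>.hom_one \<pi>.hom_inv[of alpha] by auto
    then obtain c where "C = \<pi> c" "c \<in> {\<one>\<^bsub>?B\<^esub>, alpha, braid3_inv alpha, beta}" by blast
    moreover from this(2) have "c \<in> carrier ?B" by auto
    ultimately show ?thesis by blast
  next
    case False
    then obtain w where w: "set w \<subseteq> {(1, False), (2, True)}" "w \<noteq> []" "C = word_value Q ?f w"
      using C(2) unfolding M.cyc_reduced_def by blast
    moreover from w(1) have "set w \<subseteq> {1, 2} \<times> UNIV" by auto
    ultimately show ?thesis using cls braid_class_closed[of w 3] unfolding three by metis
  qed
  then obtain c where c: "c \<in> carrier ?B" "C = \<pi> c" "c \<in> {\<one>\<^bsub>?B\<^esub>, alpha, braid3_inv alpha, beta} \<or>
     (\<exists>w. set w \<subseteq> {(1, False), (2, True)} \<and> w \<noteq> [] \<and> c = braid_class 3 w)" by blast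
  have "\<pi> g = \<pi> (h \<cdot> c \<cdot> braid3_inv h)" using \<pi>g h c by simp
  then obtain k where "g = zeta_pow k \<cdot> (h \<cdot> c \<cdot> braid3_inv h)" using \<pi>E g h c by blast
  with h c that show ?thesis by blast
qed

section \<open>The matrix representation and the exponent sum\<close>

definition rho :: "nat word set \<Rightarrow> mat2" where
  "rho = (SOME h. h \<in> hom (braid_group 3) SL2 \<and>
     h (artin 3 1) = Mat 1 (-1) 0 1 \<and> h (artin 3 2) = Mat 1 0 1 1)"

text \<open>The two matrices satisfy the braid relation, so the presentation yields such a
  homomorphism. Up to a change of basis it is the reduced Burau representation at -1.\<close>

lemma rho: "rho \<in> hom (braid_group 3) SL2"
  "rho (artin 3 1) = Mat 1 (-1) 0 1" "rho (artin 3 2) = Mat 1 0 1 1"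
proof -
  have "\<exists>h. h \<in> hom (braid_group 3) SL2 \<and>
     h (artin 3 1) = Mat 1 (-1) 0 1 \<and> h (artin 3 2) = Mat 1 0 1 1"
    using SL2.braid3_lift[of "Mat 1 (-1) 0 1" "Mat 1 0 1 1"] by force
  from someI_ex[OF this] show "rho \<in> hom (braid_group 3) SL2"
    "rho (artin 3 1) = Mat 1 (-1) 0 1" "rho (artin 3 2) = Mat 1 0 1 1"
    unfolding rho_def by blast+
qed

definition deg :: "nat word set \<Rightarrow> int" where
  "deg = (SOME h. h \<in> hom (braid_group 3) integer_group \<and> h (artin 3 1) = 1 \<and> h (artin 3 2) = 1)"

lemma deg: "deg \<in> hom (braid_group 3) integer_group" "deg (artin 3 1) = 1" "deg (artin 3 2) = 1"
proof -
  have "\<exists>h. h \<in> hom (braid_group 3) integer_group \<and> h (artin 3 1) = 1 \<and> h (artin 3 2) = 1"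
    using group.braid3_lift[OF group_integer_group, of 1 1] by force
  from someI_ex[OF this] show "deg \<in> hom (braid_group 3) integer_group"
    "deg (artin 3 1) = 1" "deg (artin 3 2) = 1"
    unfolding deg_def by blast+
qed

interpretation rho: group_hom "braid_group 3" SL2 rho
  using rho(1) by (simp add: group_hom_def group_hom_axioms_def group_braid_group SL2.is_group)

interpretation deg: group_hom "braid_group 3" integer_group deg
  using deg(1) by (simp add: group_hom_def group_hom_axioms_def group_braid_group)

lemma det2_rho [simp]: "x \<in> carrier (braid_group 3) \<Longrightarrow> det2 (rho x) = 1"
  using rho.hom_closed by simp

lemma rho_mult [simp]: "x \<in> carrier (braid_group 3) \<Longrightarrow> y \<in> carrier (braid_group 3) \<Longrightarrow>
    rho (x \<cdot> y) = rho x * rho y"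
  using rho.hom_mult by simp

lemma rho_inv [simp]: "x \<in> carrier (braid_group 3) \<Longrightarrow> rho (braid3_inv x) = adj2 (rho x)"
  using rho.hom_inv by (simp)

lemma rho_elem: "rho alpha = Mat 0 (-1) 1 1" "rho beta = Mat 0 (-1) 1 0" "rho zeta = - 1"
  by (simp_all add: alpha_def beta_def zeta_def rho one_mat2_def del: One_nat_def)

lemma deg_elem: "deg alpha = 2" "deg beta = 3" "deg zeta = 6"
  by (simp_all add: alpha_def beta_def zeta_def deg del: One_nat_def)

lemma deg_zeta_pow [simp]: "deg (zeta_pow k) = 6 * k"
  using deg.hom_int_pow[of zeta k] by (simp add: deg_elem)

lemma rho_zeta_pow: "rho (zeta_pow k) = 1 \<or> rho (zeta_pow k) = - 1"
proof -
  have n: "rho (zeta [^]\<^bsub>braid_group 3\<^esub> n) = 1 \<or> rho (zeta [^]\<^bsub>braid_group 3\<^esub> n) = - 1" for n :: nat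
    using rho.hom_one by (induction n) (auto simp: rho_elem)
  have adj: "adj2 1 = 1" "adj2 (- 1) = - 1" by (simp_all add: one_mat2_def)
  show ?thesis
  proof (cases k rule: int_cases2)
    case (nonneg m)
    then show ?thesis using n by (simp add: int_pow_int)
  next
    case (nonpos m)
    have "rho (zeta_pow k) = adj2 (rho (zeta [^]\<^bsub>braid_group 3\<^esub> m))"
      unfolding nonpos B3.int_pow_neg_int[OF elem_closed(3)] by (rule rho_inv) simp
    with n[of m] adj show ?thesis by metis
  qed
qed

lemma positive_nonscalar:
  assumes "set w \<subseteq> {(1, False), (2, True)}" "w \<noteq> []"
  shows "\<not> scalar2 (rho (braid_class 3 w))"
proof -
  let ?f = "\<lambda>i. rho (artin 3 i)"
  \<comment> \<open>The diagonal bound drives the induction: a letter on the left adds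
    \<open>d\<close> to \<open>b\<close> or \<open>a\<close> to \<open>c\<close>, so the
    off-diagonal sum grows by at least 1.\<close>
  have *: "\<exists>a b c d. word_value SL2 ?f w = Mat a b c d \<and> a \<ge> 1 \<and> b \<ge> 0 \<and> c \<ge> 0 \<and> d \<ge> 1 \<and> (w \<noteq> [] \<longrightarrow> b + c \<ge> 1)"
    using assms(1)
  proof (induction w)
    case Nil
    show ?case by (simp add: one_mat2_def)
  next
    case (Cons p w)
    then obtain a b c d where w: "word_value SL2 ?f w = Mat a b c d" "a \<ge> 1" "b \<ge> 0" "c \<ge> 0" "d \<ge> 1"
      by auto
    from Cons.prems consider "p = (1, False)" | "p = (2, True)" by auto
    then show ?case
      by cases (use w in \<open>simp_all add: rho del: One_nat_def\<close>)
  qed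
  have "set w \<subseteq> {1..<3} \<times> UNIV" using assms(1) by auto
  with * assms(2) show ?thesis by (auto simp: SL2.hom_braid_class[OF rho(1)])
qed

text \<open>Powers of \<open>zeta\<close> map to 1 or -1, so \<open>rho g\<close> is conjugate to
  \<open>rho c\<close> up to sign, and neither a sign nor a conjugation affects being
  scalar.\<close>

lemma rho_conj_scalar:
  assumes "h \<in> carrier (braid_group 3)" "c \<in> carrier (braid_group 3)"
    and g: "g = zeta_pow k \<cdot> (h \<cdot> c \<cdot> braid3_inv h)"
  shows "scalar2 (rho g) \<longleftrightarrow> scalar2 (rho c)"
    and "scalar2 (rho g * rho g) \<longleftrightarrow> scalar2 (rho c * rho c)"
    and "scalar2 (rho g * rho g * rho g) \<longleftrightarrow> scalar2 (rho c * rho c * rho c)"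
proof -
  let ?H = "rho h" and ?C = "rho c"
  define D where "D = ?H * ?C * adj2 ?H"
  have H: "det2 ?H = 1" using assms by simp
  then have cancel: "adj2 ?H * (?H * A) = A" for A
    using adj2_left[of ?H] by (simp flip: mult.assoc)
  have "rho g = rho (zeta_pow k) * D" unfolding g using assms by (simp add: D_def)
  then have g': "rho g = D \<or> rho g = - D" using rho_zeta_pow[of k] by auto
  have neg: "scalar2 (- A) \<longleftrightarrow> scalar2 A" for A by (cases A) auto
  have D: "D * D = ?H * (?C * ?C) * adj2 ?H" "D * D * D = ?H * (?C * ?C * ?C) * adj2 ?H"
    by (simp_all add: D_def mult.assoc cancel)
  have *: "scalar2 D \<longleftrightarrow> scalar2 ?C" "scalar2 (D * D) \<longleftrightarrow> scalar2 (?C * ?C)"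
    "scalar2 (D * D * D) \<longleftrightarrow> scalar2 (?C * ?C * ?C)"
    by (rule scalar2_conj[OF H, of ?C, folded D_def] scalar2_conj[OF H, of "?C * ?C", folded D(1)]
      scalar2_conj[OF H, of "?C * ?C * ?C", folded D(2)])+
  from g' have "scalar2 (rho g) \<longleftrightarrow> scalar2 D"
    "rho g * rho g = D * D" "scalar2 (rho g * rho g * rho g) \<longleftrightarrow> scalar2 (D * D * D)"
    by (elim disjE; simp add: neg)+
  with * show "scalar2 (rho g) \<longleftrightarrow> scalar2 ?C"
    "scalar2 (rho g * rho g) \<longleftrightarrow> scalar2 (?C * ?C)"
    "scalar2 (rho g * rho g * rho g) \<longleftrightarrow> scalar2 (?C * ?C * ?C)"
    by metis+
qed

text \<open>These facts sift the normal form: a scalar square excludes \<open>alpha\<close> and its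
  inverse, a scalar cube excludes \<open>beta\<close>.\<close>

lemma rho_torsion:
  "\<not> scalar2 (rho alpha)" "\<not> scalar2 (rho alpha * rho alpha)"
  "\<not> scalar2 (rho (braid3_inv alpha))" "\<not> scalar2 (rho (braid3_inv alpha) * rho (braid3_inv alpha))"
  "\<not> scalar2 (rho beta)" "\<not> scalar2 (rho beta * rho beta * rho beta)"
proof -
  have "rho (braid3_inv alpha) = Mat 1 1 (-1) 0" by (simp add: rho_elem)
  then show "\<not> scalar2 (rho (braid3_inv alpha))"
    "\<not> scalar2 (rho (braid3_inv alpha) * rho (braid3_inv alpha))" by simp_all
qed (simp_all add: rho_elem)

lemma rho_scalar_imp_zeta_pow:
  assumes "g \<in> carrier (braid_group 3)" "scalar2 (rho g)"
  shows "\<exists>k. g = zeta_pow k"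
proof -
  obtain k h c where h: "h \<in> carrier (braid_group 3)" and c: "c \<in> carrier (braid_group 3)"
    and g: "g = zeta_pow k \<cdot> (h \<cdot> c \<cdot> braid3_inv h)"
    and c': "c \<in> {\<one>\<^bsub>braid_group 3\<^esub>, alpha, braid3_inv alpha, beta} \<or>
     (\<exists>w. set w \<subseteq> {(1, False), (2, True)} \<and> w \<noteq> [] \<and> c = braid_class 3 w)"
    using braid3_normal_form[OF assms(1)] .
  have "scalar2 (rho c)" using rho_conj_scalar(1)[OF h c g] assms(2) by simp
  then have "c = \<one>\<^bsub>braid_group 3\<^esub>" using c' rho_torsion positive_nonscalar by blast
  then show ?thesis using g h by auto
qed

text \<open>The quotient of \<open>x\<close> and \<open>y\<close> has scalar image, hence is a power
  of \<open>zeta\<close>; as \<open>zeta\<close> has degree 6, degree zero makes this power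
  trivial.\<close>

lemma rho_deg_inj:
  assumes x: "x \<in> carrier (braid_group 3)" and y: "y \<in> carrier (braid_group 3)"
    and "rho x = rho y" "deg x = deg y"
  shows "x = y"
proof -
  have "rho (x \<cdot> braid3_inv y) = 1"
    using assms adj2_right[of "rho y"] by simp
  then have "scalar2 (rho (x \<cdot> braid3_inv y))" by (simp add: one_mat2_def)
  then obtain k where k: "x \<cdot> braid3_inv y = zeta_pow k"
    using rho_scalar_imp_zeta_pow x y by blast
  moreover have "deg (x \<cdot> braid3_inv y) = 0" using assms by simp
  ultimately have "6 * k = 0" by simp
  then have "x \<cdot> braid3_inv y = \<one>\<^bsub>braid_group 3\<^esub>" using k by simp
  then show ?thesis using x y by (metis B3.inv_equality B3.inv_closed B3.inv_inv)
qed

section \<open>Pairs and triples in the three-strand group satisfying braid relations\<close>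

lemma braid_deg_eq:
  assumes "x \<in> carrier (braid_group 3)" "y \<in> carrier (braid_group 3)" "x \<cdot> y \<cdot> x = y \<cdot> x \<cdot> y"
  shows "deg x = deg y"
  using arg_cong[OF assms(3), of deg] assms(1,2) by simp

lemma braid4_in_braid3_eq:
  assumes x: "x \<in> carrier (braid_group 3)" and y: "y \<in> carrier (braid_group 3)"
    and z: "z \<in> carrier (braid_group 3)"
    and xy: "x \<cdot> y \<cdot> x = y \<cdot> x \<cdot> y" and yz: "y \<cdot> z \<cdot> y = z \<cdot> y \<cdot> z" and xz: "x \<cdot> z = z \<cdot> x"
  shows "x = z"
proof (rule rho_deg_inj[OF x z])
  show "deg x = deg z" using braid_deg_eq[OF x y xy] braid_deg_eq[OF y z yz] by simp
  show "rho x = rho z"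
  proof (rule braid4_mat2_eq[of _ "rho y"])
    show "rho x * rho y * rho x = rho y * rho x * rho y"
      using arg_cong[OF xy, of rho] x y by simp
    show "rho z * rho y * rho z = rho y * rho z * rho y"
      using arg_cong[OF yz, of rho] z y by simp
    show "rho x * rho z = rho z * rho x"
      using arg_cong[OF xz, of rho] x z by simp
  qed (use x y z in simp_all)
qed

text \<open>The elements x y and x y x imitate \<open>alpha\<close> and \<open>beta\<close>: the
  cube of the first is the square of the second. The exponents 2m and 3m are m times the degrees of
  \<open>alpha\<close> and \<open>beta\<close>, so a single homomorphism into the centre removes
  both factors. The two outcomes differ by inversion.\<close>

lemma noncyclic_pair_form:
  assumes x: "x \<in> carrier (braid_group 3)" and y: "y \<in> carrier (braid_group 3)"
    and xy: "x \<cdot> y \<cdot> x = y \<cdot> x \<cdot> y" and ne: "x \<noteq> y"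
  obtains g h m where "g \<in> carrier (braid_group 3)" "h \<in> carrier (braid_group 3)"
      "x \<cdot> y = zeta_pow (2 * m) \<cdot> (g \<cdot> alpha \<cdot> braid3_inv g)"
      "x \<cdot> y \<cdot> x = zeta_pow (3 * m) \<cdot> (h \<cdot> beta \<cdot> braid3_inv h)"
  | g h m where "g \<in> carrier (braid_group 3)" "h \<in> carrier (braid_group 3)"
      "x \<cdot> y = zeta_pow (2 * m) \<cdot> (g \<cdot> braid3_inv alpha \<cdot> braid3_inv g)"
      "x \<cdot> y \<cdot> x = zeta_pow (3 * m) \<cdot> (h \<cdot> braid3_inv beta \<cdot> braid3_inv h)"
proof -
  let ?B = "braid_group 3"
  define a where "a = x \<cdot> y"
  define b where "b = x \<cdot> y \<cdot> x"
  have a: "a \<in> carrier ?B" and b: "b \<in> carrier ?B" using x y by (simp_all add: a_def b_def)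
  have "a \<cdot> a \<cdot> a = (x \<cdot> y \<cdot> x) \<cdot> (y \<cdot> x \<cdot> y)" using x y by (simp add: a_def B3.m_assoc)
  then have ab: "a \<cdot> a \<cdot> a = b \<cdot> b" by (simp add: b_def flip: xy)
  have nc: "a \<cdot> b \<noteq> b \<cdot> a"
  proof
    assume "a \<cdot> b = b \<cdot> a"
    then have "(x \<cdot> y) \<cdot> (x \<cdot> (y \<cdot> x)) = (x \<cdot> y) \<cdot> (x \<cdot> (x \<cdot> y))"
      using x y by (simp add: a_def b_def B3.m_assoc)
    then have "x \<cdot> (y \<cdot> x) = x \<cdot> (x \<cdot> y)"
      using x y B3.Units_l_cancel[of "x \<cdot> y" "x \<cdot> (y \<cdot> x)" "x \<cdot> (x \<cdot> y)"] by simp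
    then have "x \<cdot> y = y \<cdot> x"
      using x y B3.Units_l_cancel[of x "y \<cdot> x" "x \<cdot> y"] by simp
    with ne show False using B3.braid_commute_imp_eq[OF x y xy] by blast
  qed
  let ?A = "rho a" and ?C = "rho b"
  \<comment> \<open>The products a b and b a have the same degree, so the matrices alone must detect
    that they differ.\<close>
  have AC: "?A * ?C \<noteq> ?C * ?A"
  proof
    assume "?A * ?C = ?C * ?A"
    then have "a \<cdot> b = b \<cdot> a" using a b by (intro rho_deg_inj) simp_all
    with nc show False by blast
  qed
  have cube: "?A * ?A * ?A = ?C * ?C" using arg_cong[OF ab, of rho] a b by simp
  have sA: "\<not> scalar2 ?A" and sC: "\<not> scalar2 ?C"
    using AC scalar2_central[of ?A ?C] scalar2_central[of ?C ?A] by auto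
  \<comment> \<open>The common value of cube and square commutes with both matrices. Were it not
    scalar, its commutative centralizer would make them commute.\<close>
  have "?C * ?C * ?A = ?A * (?C * ?C)" "?C * ?C * ?C = ?C * (?C * ?C)"
    unfolding cube[symmetric] by (simp_all only: mult.assoc cube) (simp only: mult.assoc[symmetric] cube)
  then have s2: "scalar2 (?C * ?C)" using commute_nonscalar2[of "?C * ?C" ?A ?C] AC by blast
  then have s3: "scalar2 (?A * ?A * ?A)" unfolding cube .
  \<comment> \<open>Squares and cubes of nonempty positive words are again nonempty positive
    words.\<close>
  have pos: "\<not> scalar2 (rho (braid_class 3 w) * rho (braid_class 3 w))"
    "\<not> scalar2 (rho (braid_class 3 w) * rho (braid_class 3 w) * rho (braid_class 3 w))"
    if w: "set w \<subseteq> {(1, False), (2, True)}" "w \<noteq> []" for w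
  proof -
    have app: "rho (braid_class 3 u) * rho (braid_class 3 v) = rho (braid_class 3 (u @ v))"
      if "set u \<subseteq> {(1, False), (2, True)}" "set v \<subseteq> {(1, False), (2, True)}" for u v
    proof -
      have uv: "set u \<subseteq> {1..<3} \<times> UNIV" "set v \<subseteq> {1..<3} \<times> UNIV" using that by auto
      then have "braid_class 3 u \<cdot> braid_class 3 v = braid_class 3 (u @ v)"
        unfolding braid_class_def braid_group_def by (rule pres_mult)
      then show ?thesis using rho_mult[OF braid_class_closed[OF uv(1)] braid_class_closed[OF uv(2)]] by simp
    qed
    show "\<not> scalar2 (rho (braid_class 3 w) * rho (braid_class 3 w))"
      "\<not> scalar2 (rho (braid_class 3 w) * rho (braid_class 3 w) * rho (braid_class 3 w))"
      using w by (simp_all add: app positive_nonscalar)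
  qed
  obtain k g c where g: "g \<in> carrier ?B" and c: "c \<in> carrier ?B"
    and ak: "a = zeta_pow k \<cdot> (g \<cdot> c \<cdot> braid3_inv g)"
    and c': "c \<in> {\<one>\<^bsub>?B\<^esub>, alpha, braid3_inv alpha, beta} \<or>
     (\<exists>w. set w \<subseteq> {(1, False), (2, True)} \<and> w \<noteq> [] \<and> c = braid_class 3 w)"
    using braid3_normal_form[OF a] .
  have s1: "scalar2 (rho \<one>\<^bsub>?B\<^esub>)" using rho.hom_one by (simp add: one_mat2_def)
  have "c \<noteq> \<one>\<^bsub>?B\<^esub>" using rho_conj_scalar(1)[OF g c ak] sA s1 by auto
  moreover have "scalar2 (rho c * rho c * rho c)" using rho_conj_scalar(3)[OF g c ak] s3 by simp
  ultimately have c_cases: "c = alpha \<or> c = braid3_inv alpha"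
    using c' pos(2) rho_torsion by blast
  obtain l h d where h: "h \<in> carrier ?B" and d: "d \<in> carrier ?B"
    and bl: "b = zeta_pow l \<cdot> (h \<cdot> d \<cdot> braid3_inv h)"
    and d': "d \<in> {\<one>\<^bsub>?B\<^esub>, alpha, braid3_inv alpha, beta} \<or>
     (\<exists>w. set w \<subseteq> {(1, False), (2, True)} \<and> w \<noteq> [] \<and> d = braid_class 3 w)"
    using braid3_normal_form[OF b] .
  have "d \<noteq> \<one>\<^bsub>?B\<^esub>" using rho_conj_scalar(1)[OF h d bl] sC s1 by auto
  moreover have "scalar2 (rho d * rho d)" using rho_conj_scalar(2)[OF h d bl] s2 by simp
  ultimately have d_beta: "d = beta"
    using d' pos(1) rho_torsion by blast
  have "deg a = 6 * k + deg c" "deg b = 6 * l + 3"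
    using g h c by (simp_all add: ak bl d_beta deg_elem)
  moreover have "3 * deg a = 2 * deg b" using arg_cong[OF ab, of deg] a b by simp
  \<comment> \<open>Degrees in the equality of cube and square tie \<open>k\<close> to
    \<open>l\<close>; divisibility by 2 and 3 then produces the common parameter
    \<open>m\<close>.\<close>
  ultimately have kl: "18 * k + 3 * deg c = 12 * l + 6" by simp
  from c_cases show ?thesis
  proof
    assume ca: "c = alpha"
    then have "3 * k = 2 * l" using kl by (simp add: deg_elem)
    then have "\<exists>m. k = 2 * m \<and> l = 3 * m" by presburger
    then obtain m where m: "k = 2 * m" "l = 3 * m" by blast
    show ?thesis
      using that(1)[OF g h ak[unfolded ca m a_def] bl[unfolded d_beta m b_def]] .
  next
    assume ca: "c = braid3_inv alpha"
    then have "3 * k = 2 * l + 2" using kl by (simp add: deg_elem)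
    then have "\<exists>m. k = 2 * m \<and> l + 1 = 3 * m" by presburger
    then obtain m where m: "k = 2 * m" "l + 1 = 3 * m" by blast
    let ?D = "h \<cdot> braid3_inv beta \<cdot> braid3_inv h"
    have D: "?D \<in> carrier ?B" using h by simp
    \<comment> \<open>As \<open>beta\<close> is \<open>zeta\<close> times its own inverse, passing
      to the inverse costs one power of \<open>zeta\<close> and raises the exponent from
      \<open>l\<close> to l + 1 = 3m.\<close>
    have "h \<cdot> beta = h \<cdot> (zeta \<cdot> braid3_inv beta)" by (simp add: zeta_def B3.m_assoc)
    also have "\<dots> = (h \<cdot> zeta) \<cdot> braid3_inv beta" using h by (simp only: B3.m_assoc elem_closed B3.inv_closed)
    also have "\<dots> = zeta \<cdot> (h \<cdot> braid3_inv beta)"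
      unfolding zeta_commute[OF h, symmetric] using h by (simp only: B3.m_assoc elem_closed B3.inv_closed)
    finally have "h \<cdot> beta \<cdot> braid3_inv h = zeta \<cdot> ?D"
      using h by (simp only: B3.m_assoc elem_closed B3.inv_closed B3.m_closed)
    then have "b = zeta_pow l \<cdot> (zeta \<cdot> ?D)" by (simp only: bl d_beta)
    also have "\<dots> = zeta_pow l \<cdot> zeta_pow 1 \<cdot> ?D"
      using D by (simp only: B3.m_assoc elem_closed B3.int_pow_closed B3.int_pow_1)
    finally have b': "b = zeta_pow (l + 1) \<cdot> ?D" by (simp only: B3.int_pow_mult elem_closed)
    show ?thesis
      using that(2)[OF g h ak[unfolded ca m a_def] b'[unfolded m b_def]] .
  qed
qed

section \<open>Homomorphisms into the three-strand braid group\<close>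

text \<open>Consecutive triples identify the images of generators with indices of equal parity.
  Generators 1 and 4 commute, and 4 has the image of 2, so the images of 1 and 2 commute and the
  braid relation makes them equal. The bound 5 makes generator 4 available.\<close>

lemma braid_hom_artin_const:
  assumes h: "h \<in> hom (braid_group n) (braid_group 3)" and n: "n \<ge> 5"
  shows "i \<in> {1..<n} \<Longrightarrow> h (artin n i) = h (artin n 1)"
proof -
  let ?s = "\<lambda>i. h (artin n i)"
  note rel = braid_hom_relations[OF h]
  have two: "?s i = ?s (i + 2)" if "i \<ge> 1" "i + 2 < n" for i
  proof -
    have i: "i \<in> {1..<n}" "i + 1 \<in> {1..<n}" "i + 2 \<in> {1..<n}" using that by auto
    have i2: "i + 1 + 1 = i + 2" by simp
    show ?thesis
      by (rule braid4_in_braid3_eq[of _ "?s (i + 1)"])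
        (rule rel(1)[OF i(1)] rel(1)[OF i(2)] rel(1)[OF i(3)] rel(2)[OF i(1,2)]
          rel(2)[of "i + 1", unfolded i2, OF i(2,3)] rel(3)[OF i(1,3) order_refl])+
  qed
  have one: "?s 1 = ?s 2"
  proof (rule B3.braid_commute_imp_eq)
    show "?s 1 \<in> carrier (braid_group 3)" "?s 2 \<in> carrier (braid_group 3)"
      using n by (auto intro!: rel(1))
    show "?s 1 \<cdot> ?s 2 \<cdot> ?s 1 = ?s 2 \<cdot> ?s 1 \<cdot> ?s 2"
      by (rule rel(2)[of 1, unfolded one_add_one]) (use n in auto)
    have "(2::nat) + 2 = 4" by simp
    then have s4: "?s 2 = ?s 4" using two[of 2] n by simp
    show "?s 1 \<cdot> ?s 2 = ?s 2 \<cdot> ?s 1" unfolding s4 by (rule rel(3)) (use n in auto)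
  qed
  have "i < n \<longrightarrow> ?s i = ?s 1" if "i \<ge> 1" for i
    using that
  proof (induction i rule: less_induct)
    case (less i)
    then consider "i = 1" | "i = 2" | "i \<ge> 3" by linarith
    then show ?case
    proof cases
      case 3
      then have "i - 2 + 2 = i" "i - 2 \<ge> 1" "i - 2 < i" by auto
      with two[of "i - 2"] less.IH[of "i - 2"] show ?thesis by auto
    qed (use one in simp_all)
  qed
  then show "i \<in> {1..<n} \<Longrightarrow> ?s i = ?s 1" by (meson atLeastLessThan_iff)
qed

text \<open>Once the first and third generators have the same image, the first two images satisfy
  the defining relation of the three-strand group and determine the factor
  \<open>\<psi>\<close>.\<close>

lemma braid_hom_factor:
  assumes h: "h \<in> hom (braid_group 4) (braid_group 3)"
  shows "\<exists>\<psi>\<in>hom (braid_group 3) (braid_group 3). \<forall>x\<in>carrier (braid_group 4). h x = \<psi> (R_star x)"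
proof -
  let ?s = "\<lambda>i. h (artin 4 i)"
  note rel = braid_hom_relations[OF h]
  have s: "?s 1 \<in> carrier (braid_group 3)" "?s 2 \<in> carrier (braid_group 3)" "?s 3 \<in> carrier (braid_group 3)"
    by (rule rel; simp)+
  have b: "?s 1 \<cdot> ?s 2 \<cdot> ?s 1 = ?s 2 \<cdot> ?s 1 \<cdot> ?s 2"
    using rel(2)[of 1] by (simp add: numeral_2_eq_2)
  have eq: "?s 1 = ?s 3"
  proof (rule braid4_in_braid3_eq[OF s b])
    show "?s 2 \<cdot> ?s 3 \<cdot> ?s 2 = ?s 3 \<cdot> ?s 2 \<cdot> ?s 3" using rel(2)[of 2] by simp
    show "?s 1 \<cdot> ?s 3 = ?s 3 \<cdot> ?s 1" using rel(3)[of 1 3] by simp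
  qed
  obtain \<psi> where \<psi>: "\<psi> \<in> hom (braid_group 3) (braid_group 3)"
    "\<psi> (artin 3 1) = ?s 1" "\<psi> (artin 3 2) = ?s 2"
    using B3.braid3_lift[OF s(1,2) b] .
  have comp: "\<psi> \<circ> R_star \<in> hom (braid_group 4) (braid_group 3)"
    using hom_compose[OF R_star_hom \<psi>(1)] .
  have "h (artin 4 i) = (\<psi> \<circ> R_star) (artin 4 i)" if "i \<in> {1..<4}" for i
  proof -
    have "i = 1 \<or> i = 2 \<or> i = 3" using that by auto
    then show ?thesis using R_star_artin \<psi> eq by (elim disjE) (simp_all only: comp_apply)
  qed
  then show ?thesis using B3.braid_hom_eqI[OF h comp] \<psi>(1) by (intro bexI[of _ \<psi>]) auto
qed

section \<open>Automorphisms and central transvections\<close>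

lemma conj_iso:
  assumes h: "h \<in> carrier (braid_group 3)"
  shows "(\<lambda>x. braid3_inv h \<cdot> x \<cdot> h) \<in> iso (braid_group 3) (braid_group 3)"
proof (rule isoI)
  have c: "h \<cdot> (braid3_inv h \<cdot> x) = x" "braid3_inv h \<cdot> (h \<cdot> x) = x"
    if "x \<in> carrier (braid_group 3)" for x
    using h that by (simp_all flip: B3.m_assoc)
  show "(\<lambda>x. braid3_inv h \<cdot> x \<cdot> h) \<in> hom (braid_group 3) (braid_group 3)"
    by (rule homI) (use h c in \<open>simp_all add: B3.m_assoc\<close>)
  show "bij_betw (\<lambda>x. braid3_inv h \<cdot> x \<cdot> h) (carrier (braid_group 3)) (carrier (braid_group 3))"
    by (rule bij_betw_byWitness[of _ "\<lambda>x. h \<cdot> x \<cdot> braid3_inv h"])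
      (use h c in \<open>auto simp: B3.m_assoc\<close>)
qed

text \<open>Inverting both sides of the braid relation gives the same relation for the inverse
  generators. The resulting map is its own inverse, and it exchanges the two outcomes of the pair
  form.\<close>

lemma inversion_iso:
  obtains \<iota> where "\<iota> \<in> iso (braid_group 3) (braid_group 3)"
    "\<iota> (artin 3 1) = braid3_inv (artin 3 1)" "\<iota> (artin 3 2) = braid3_inv (artin 3 2)"
proof -
  let ?B = "braid_group 3"
  let ?s = "artin 3 1" and ?t = "artin 3 2"
  have "braid3_inv (?s \<cdot> ?t \<cdot> ?s) = braid3_inv (?t \<cdot> ?s \<cdot> ?t)" by (simp only: artin3_braid)
  then have "braid3_inv ?s \<cdot> braid3_inv ?t \<cdot> braid3_inv ?s
      = braid3_inv ?t \<cdot> braid3_inv ?s \<cdot> braid3_inv ?t"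
    by (simp only: B3.inv_mult_group gen_closed B3.m_closed B3.m_assoc B3.inv_closed)
  then obtain \<iota> where \<iota>: "\<iota> \<in> hom ?B ?B" "\<iota> ?s = braid3_inv ?s" "\<iota> ?t = braid3_inv ?t"
    using B3.braid3_lift[of "braid3_inv ?s" "braid3_inv ?t"] B3.inv_closed gen_closed by metis
  interpret \<iota>: group_hom ?B ?B \<iota>
    using \<iota>(1) by (simp add: group_hom_def group_hom_axioms_def group_braid_group)
  have id: "(\<lambda>x. x) \<in> hom ?B ?B" by (rule homI) auto
  have inv: "\<iota> (\<iota> x) = x" if "x \<in> carrier ?B" for x
  proof -
    have "(\<iota> \<circ> \<iota>) (artin 3 i) = artin 3 i" if "i \<in> {1..<3}" for i
    proof -
      have "i = 1 \<or> i = 2" using that by auto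
      then show ?thesis
        by (elim disjE) (simp_all only: comp_apply \<iota> \<iota>.hom_inv gen_closed B3.inv_inv)
    qed
    from B3.braid_hom_eqI[OF hom_compose[OF \<iota>(1) \<iota>(1)] id this that] show ?thesis by simp
  qed
  have "bij_betw \<iota> (carrier ?B) (carrier ?B)"
    by (rule bij_betw_byWitness[of _ \<iota>]) (use inv in auto)
  then show ?thesis using that[of \<iota>] \<iota> by (simp add: iso_def)
qed

lemma zeta_pow_hom:
  "(\<lambda>x. zeta_pow (m * deg x)) \<in> hom (braid_group 3) ((braid_group 3)\<lparr>carrier := center (braid_group 3)\<rparr>)"
  by (rule homI) (simp_all add: zeta_pow_center B3.int_pow_mult distrib_left)

text \<open>Powers of \<open>zeta\<close> are central, hence lie in the centralizer of any image.
  Both Artin generators have degree 1, so both map to \<open>zeta_pow m\<close> and the image is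
  cyclic.\<close>

lemma zeta_pow_transvection_datum:
  assumes \<phi>: "\<phi> \<in> hom (braid_group 3) (braid_group 3)"
  shows "transvection_datum (braid_group 3) (braid_group 3) \<phi> (\<lambda>x. zeta_pow (m * deg x))"
proof -
  let ?C = "centralizer (braid_group 3) (\<phi> ` carrier (braid_group 3))"
  let ?H = "(braid_group 3)\<lparr>carrier := ?C\<rparr>"
  have sub: "subgroup ?C (braid_group 3)"
  proof (rule B3.subgroupI)
    have im: "\<phi> x \<in> carrier (braid_group 3)" if "x \<in> carrier (braid_group 3)" for x
      using \<phi> that by (rule hom_in_carrier)
    show "?C \<subseteq> carrier (braid_group 3)" by (auto simp: centralizer_def)
    have "\<one>\<^bsub>braid_group 3\<^esub> \<in> ?C" using im by (simp add: centralizer_def)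
    then show "?C \<noteq> {}" by blast
    show "braid3_inv a \<in> ?C" if "a \<in> ?C" for a
    proof -
      have a: "a \<in> carrier (braid_group 3)"
        and c: "\<And>x. x \<in> carrier (braid_group 3) \<Longrightarrow> a \<cdot> \<phi> x = \<phi> x \<cdot> a"
        using that by (auto simp: centralizer_def)
      show ?thesis
        using a B3.commute_inv[OF a im c[symmetric], symmetric] by (auto simp: centralizer_def)
    qed
    show "a \<cdot> b \<in> ?C" if "a \<in> ?C" "b \<in> ?C" for a b
    proof -
      have ab: "a \<in> carrier (braid_group 3)" "b \<in> carrier (braid_group 3)"
        and c: "\<And>x. x \<in> carrier (braid_group 3) \<Longrightarrow> a \<cdot> \<phi> x = \<phi> x \<cdot> a"
          "\<And>x. x \<in> carrier (braid_group 3) \<Longrightarrow> b \<cdot> \<phi> x = \<phi> x \<cdot> b"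
        using that by (auto simp: centralizer_def)
      have "a \<cdot> b \<cdot> \<phi> x = \<phi> x \<cdot> (a \<cdot> b)" if x: "x \<in> carrier (braid_group 3)" for x
      proof -
        have "a \<cdot> b \<cdot> \<phi> x = a \<cdot> (\<phi> x \<cdot> b)" using ab im[OF x] by (simp only: B3.m_assoc c(2)[OF x])
        also have "\<dots> = \<phi> x \<cdot> a \<cdot> b" using ab im[OF x] by (simp only: B3.m_assoc[symmetric] c(1)[OF x])
        finally show ?thesis using ab im[OF x] by (simp only: B3.m_assoc)
      qed
      then show ?thesis using ab by (auto simp: centralizer_def)
    qed
  qed
  interpret H: group ?H by (rule B3.subgroup_imp_group[OF sub])
  have t: "(\<lambda>x. zeta_pow (m * deg x)) \<in> hom (braid_group 3) ?H"
  proof (rule homI)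
    fix x assume "x \<in> carrier (braid_group 3)"
    show "zeta_pow (m * deg x) \<in> carrier ?H"
      using zeta_pow_commute[OF hom_in_carrier[OF \<phi>]] by (simp add: centralizer_def)
  next
    fix x y assume "x \<in> carrier (braid_group 3)" "y \<in> carrier (braid_group 3)"
    then show "zeta_pow (m * deg (x \<cdot> y)) = zeta_pow (m * deg x) \<otimes>\<^bsub>?H\<^esub> zeta_pow (m * deg y)"
      by (simp add: distrib_left B3.int_pow_mult)
  qed
  have "zeta_pow (m * deg (artin 3 i)) = zeta_pow m" if "i \<in> {1..<3}" for i
  proof -
    have "i = 1 \<or> i = 2" using that by auto
    then show ?thesis using deg(2,3) by (elim disjE) (simp_all only: mult_1_right)
  qed
  then show ?thesis unfolding transvection_datum_def
    by (intro H.cyclic_hom_if_artin_eq[OF t, of "zeta_pow m"]) simp_all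
qed

text \<open>The pair form gives the images of \<open>alpha\<close> and \<open>beta\<close> up to
  central factors and conjugation. A transvection strips the central factors, and conjugation by the
  inverse of \<open>h\<close>, followed by inversion in the second case, restores
  \<open>beta\<close>.\<close>

lemma noncyclic_braid3_hom:
  assumes \<phi>: "\<phi> \<in> hom (braid_group 3) (braid_group 3)"
    and nc: "\<not> cyclic_hom (braid_group 3) (braid_group 3) \<phi>"
  shows "\<exists>t \<in> hom (braid_group 3) ((braid_group 3)\<lparr>carrier := center (braid_group 3)\<rparr>).
    \<exists>\<theta> \<in> iso (braid_group 3) (braid_group 3). \<exists>g \<in> carrier (braid_group 3).
      transvection_datum (braid_group 3) (braid_group 3) \<phi> t \<and>
      \<theta> (transvection (braid_group 3) \<phi> t alpha) = g \<cdot> alpha \<cdot> braid3_inv g \<and>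
      \<theta> (transvection (braid_group 3) \<phi> t beta) = beta"
proof -
  let ?B = "braid_group 3"
  let ?x = "\<phi> (artin 3 1)" and ?y = "\<phi> (artin 3 2)"
  interpret \<phi>: group_hom ?B ?B \<phi>
    using \<phi> by (simp add: group_hom_def group_hom_axioms_def group_braid_group)
  have xy: "?x \<in> carrier ?B" "?y \<in> carrier ?B" by (rule \<phi>.hom_closed gen_closed)+
  have br: "?x \<cdot> ?y \<cdot> ?x = ?y \<cdot> ?x \<cdot> ?y"
    using arg_cong[OF artin3_braid, of \<phi>] by (simp only: \<phi>.hom_mult gen_closed B3.m_closed)
  have ne: "?x \<noteq> ?y"
  proof
    assume "?x = ?y"
    moreover have "i = 1 \<or> i = 2" if "i \<in> {1..<3}" for i :: nat using that by auto
    ultimately have const: "\<phi> (artin 3 i) = ?x" if "i \<in> {1..<3}" for i using that by metis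
    have "cyclic_hom ?B ?B \<phi>" by (rule B3.cyclic_hom_if_artin_eq[OF \<phi> _ const]) simp_all
    with nc show False by blast
  qed
  have im: "\<phi> alpha = ?x \<cdot> ?y" "\<phi> beta = ?x \<cdot> ?y \<cdot> ?x"
    unfolding alpha_def beta_def by (simp_all only: \<phi>.hom_mult gen_closed B3.m_closed)
  \<comment> \<open>The sign is chosen to cancel the factors \<open>zeta_pow (2 * m)\<close> and
    \<open>zeta_pow (3 * m)\<close>, as \<open>alpha\<close> and \<open>beta\<close> have degrees 2
    and 3.\<close>
  let ?t = "\<lambda>m x. zeta_pow (- m * deg x)"
  have trans: "transvection ?B \<phi> (?t m) z = c"
    if "\<phi> z = zeta_pow (k * m) \<cdot> c" "c \<in> carrier ?B" "deg z = k" for m k z c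
  proof -
    have "transvection ?B \<phi> (?t m) z = zeta_pow (- m * k) \<cdot> (zeta_pow (k * m) \<cdot> c)"
      unfolding transvection_def that(1,3) using that(2)
      by (intro zeta_pow_commute[symmetric] B3.m_closed B3.int_pow_closed elem_closed)
    also have "\<dots> = zeta_pow (- m * k) \<cdot> zeta_pow (k * m) \<cdot> c"
      using that(2) by (simp only: B3.m_assoc B3.int_pow_closed elem_closed)
    also have "\<dots> = zeta_pow (- m * k + k * m) \<cdot> c"
      by (simp only: B3.int_pow_mult elem_closed)
    finally show ?thesis using that(2) by simp
  qed
  have conj: "braid3_inv h \<cdot> (g \<cdot> c \<cdot> braid3_inv g) \<cdot> h
      = (braid3_inv h \<cdot> g) \<cdot> c \<cdot> braid3_inv (braid3_inv h \<cdot> g)"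
    if "h \<in> carrier ?B" "g \<in> carrier ?B" "c \<in> carrier ?B" for g h c
    using that by (simp add: B3.inv_mult_group B3.m_assoc)
  note t = zeta_pow_hom zeta_pow_transvection_datum[OF \<phi>]
  from xy br ne show ?thesis
  proof (cases rule: noncyclic_pair_form)
    case (1 g h m)
    let ?\<theta> = "\<lambda>x. braid3_inv h \<cdot> x \<cdot> h"
    have "transvection ?B \<phi> (?t m) alpha = g \<cdot> alpha \<cdot> braid3_inv g"
      "transvection ?B \<phi> (?t m) beta = h \<cdot> beta \<cdot> braid3_inv h"
      using 1 by (intro trans; simp add: im deg_elem)+
    then have "?\<theta> (transvection ?B \<phi> (?t m) alpha) = (braid3_inv h \<cdot> g) \<cdot> alpha \<cdot> braid3_inv (braid3_inv h \<cdot> g)"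
      "?\<theta> (transvection ?B \<phi> (?t m) beta) = beta"
      using 1 conj by simp_all
    then show ?thesis using t[of "- m"] conj_iso[of h] 1
      by (intro bexI[of _ "?t m"] bexI[of _ ?\<theta>] bexI[of _ "braid3_inv h \<cdot> g"] conjI)
        (assumption | simp)+
  next
    case (2 g h m)
    obtain \<iota> where \<iota>: "\<iota> \<in> iso ?B ?B"
      "\<iota> (artin 3 1) = braid3_inv (artin 3 1)" "\<iota> (artin 3 2) = braid3_inv (artin 3 2)"
      using inversion_iso .
    interpret \<iota>: group_hom ?B ?B \<iota>
      using \<iota>(1) by (simp add: group_hom_def group_hom_axioms_def group_braid_group iso_def)
    let ?\<theta> = "\<lambda>x. \<iota> (braid3_inv h \<cdot> x \<cdot> h)"
    let ?s = "artin 3 1" and ?t2 = "artin 3 2"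
    have \<theta>: "?\<theta> \<in> iso ?B ?B"
      using iso_set_trans[OF conj_iso[OF 2(2)] \<iota>(1)] by (simp add: comp_def)
    \<comment> \<open>Inversion sends the inverse of \<open>alpha\<close> to its letters in reverse
      order, a conjugate of \<open>alpha\<close> by the first generator; this accounts for the last
      factor of \<open>?g\<close> below.\<close>
    have "\<iota> (braid3_inv alpha) = ?t2 \<cdot> ?s"
      unfolding alpha_def by (simp only: \<iota>.hom_inv \<iota>.hom_mult gen_closed B3.m_closed \<iota>
        B3.inv_mult_group B3.inv_closed B3.inv_inv)
    also have "\<dots> = braid3_inv ?s \<cdot> alpha \<cdot> ?s"
      by (simp add: alpha_def B3.m_assoc[symmetric] del: One_nat_def)
    finally have \<iota>a: "\<iota> (braid3_inv alpha) = braid3_inv ?s \<cdot> alpha \<cdot> ?s" .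
    \<comment> \<open>The word defining \<open>beta\<close> is a palindrome, so reversing it gives
      \<open>beta\<close> itself.\<close>
    have \<iota>b: "\<iota> (braid3_inv beta) = beta"
      unfolding beta_def by (simp only: \<iota>.hom_inv \<iota>.hom_mult gen_closed B3.m_closed \<iota>
        B3.inv_mult_group B3.inv_closed B3.inv_inv B3.m_assoc)
    let ?k = "braid3_inv h \<cdot> g" and ?g = "\<iota> (braid3_inv h \<cdot> g) \<cdot> braid3_inv ?s"
    have k: "\<iota> ?k \<in> carrier ?B" "?g \<in> carrier ?B" using 2 by (simp_all del: One_nat_def)
    have tr: "transvection ?B \<phi> (?t m) alpha = g \<cdot> braid3_inv alpha \<cdot> braid3_inv g"
      "transvection ?B \<phi> (?t m) beta = h \<cdot> braid3_inv beta \<cdot> braid3_inv h"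
      using 2 by (intro trans; simp add: im deg_elem)+
    have "?\<theta> (transvection ?B \<phi> (?t m) alpha) = \<iota> ?k \<cdot> \<iota> (braid3_inv alpha) \<cdot> braid3_inv (\<iota> ?k)"
      unfolding tr conj[OF 2(2,1) B3.inv_closed[OF elem_closed(1)]]
      using 2 by (simp only: \<iota>.hom_mult \<iota>.hom_inv B3.m_closed B3.inv_closed elem_closed)
    also have "\<dots> = ?g \<cdot> alpha \<cdot> braid3_inv ?g"
      unfolding \<iota>a using k(1) by (simp add: B3.inv_mult_group B3.m_assoc del: One_nat_def)
    finally have 3: "?\<theta> (transvection ?B \<phi> (?t m) alpha) = ?g \<cdot> alpha \<cdot> braid3_inv ?g" .
    have "braid3_inv h \<cdot> (h \<cdot> braid3_inv beta \<cdot> braid3_inv h) \<cdot> h = braid3_inv beta"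
      unfolding conj[OF 2(2,2) B3.inv_closed[OF elem_closed(2)]] using 2 by simp
    then have 4: "?\<theta> (transvection ?B \<phi> (?t m) beta) = beta" by (simp only: tr \<iota>b)
    show ?thesis using t[of "- m"] \<theta> k(2) 3 4 by (intro bexI conjI) auto
  qed
qed

theorem theorem2p8:
  fixes n :: nat and \<phi> :: "nat word set \<Rightarrow> nat word set"
  assumes "\<phi> \<in> hom (braid_group n) (braid_group 3)"
  shows "(n \<ge> 5 \<longrightarrow> cyclic_hom (braid_group n) (braid_group 3) \<phi>) \<and>
    (n = 4 \<longrightarrow> (\<exists>\<psi> \<in> hom (braid_group 3) (braid_group 3).
       \<forall>x \<in> carrier (braid_group 4). \<phi> x = \<psi> (R_star x))) \<and>
    (n = 3 \<and> \<not> cyclic_hom (braid_group n) (braid_group 3) \<phi> \<longrightarrow>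
       (\<exists>t \<in> hom (braid_group 3) ((braid_group 3)\<lparr>carrier := center (braid_group 3)\<rparr>).
        \<exists>\<theta> \<in> iso (braid_group 3) (braid_group 3).
        \<exists>g \<in> carrier (braid_group 3).
          transvection_datum (braid_group 3) (braid_group 3) \<phi> t \<and>
          \<theta> (transvection (braid_group 3) \<phi> t alpha)
            = g \<otimes>\<^bsub>braid_group 3\<^esub> alpha \<otimes>\<^bsub>braid_group 3\<^esub> inv\<^bsub>braid_group 3\<^esub> g \<and>
          \<theta> (transvection (braid_group 3) \<phi> t beta) = beta))"
proof (intro conjI impI)
  assume n: "n \<ge> 5"
  show "cyclic_hom (braid_group n) (braid_group 3) \<phi>"
    by (rule B3.cyclic_hom_if_artin_eq[OF assms _ braid_hom_artin_const[OF assms n]]) (use n in simp_all)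
qed (use assms braid_hom_factor noncyclic_braid3_hom in auto)

end
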